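(* Let $\mathcal H$ be a finite-dimensional complex Hilbert space, $H=H^\dagger$ a Hamiltonian on $\mathcal H$, and $|\psi\rangle\in\mathcal H$ a unit vector that is not an eigenvector of $H$; put $|\psi_t\rangle=e^{-itH}|\psi\rangle$, $t\in\mathbb R$. Let $\epsilon>0$ and $c>0$, and for every $N\in\mathbb N$ let $\mathcal P_{\mathrm{yes},N}$ be a (probabilistic) replication process for the states $\{|\psi_t\rangle\}_{t\in\mathbb R}$ transforming $N$ input copies into $M=M(N)$ approximate copies, where $M(N)\ge c\,N^{2+\epsilon}$. Then the fidelity of the replicas vanishes asymptotically: $\lim_{N\to\infty}F[\mathcal P_{\mathrm{yes},N}]=0$.
   Context: A (probabilistic) replication process from $N$ to $M$ copies is a completely positive, trace non-increasing linear map $\mathcal P_{\mathrm{yes}}$ from operators on $\mathcal H^{\otimes N}$ to operators on $\mathcal H^{\otimes M}$ (the "successful" branch of a quantum instrument $\{\mathcal P_{\mathrm{yes}},\mathcal P_{\mathrm{no}}\}$) such that $\mathrm{Tr}\big[\mathcal P_{\mathrm{yes}}\big((|\psi_t\rangle\langle\psi_t|)^{\otimes N}\big)\big]\neq 0$ for at least one $t$. Its (worst-case, global) fidelity is $$F[\mathcal P_{\mathrm{yes}}]=\inf_{t}\frac{\langle\psi_t|^{\otimes M}\,\mathcal P_{\mathrm{yes}}\big((|\psi_t\rangle\langle\psi_t|)^{\otimes N}\big)\,|\psi_t\rangle^{\otimes M}}{\mathrm{Tr}\big[\mathcal P_{\mathrm{yes}}\big((|\psi_t\rangle\langle\psi_t|)^{\otimes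 N}\big)\big]},$$ the infimum being over those $t\in\mathbb R$ for which the denominator is nonzero. No lower bound on the success probability is assumed. *)

theory Defs
  imports Complex_Main
    "Jordan_Normal_Form.Char_Poly"
    "Jordan_Normal_Form.Schur_Decomposition"
begin

text \<open>
  A complex Hilbert space of dimension \<open>d\<close> is \<open>carrier_vec d\<close> with inner product
  \<open>\<langle>u|v\<rangle> = v \<bullet>c u\<close> (the operation \<open>\<bullet>c\<close> conjugates its right argument), and its
  \<open>N\<close>-th tensor power is \<open>carrier_vec (d ^ N)\<close> through the Kronecker product.
\<close>

definition mat_trace :: "complex mat \<Rightarrow> complex" where
  "mat_trace A = (\<Sum>i<dim_row A. A $$ (i, i))"

text \<open>In the complex order, \<open>0 \<le> z\<close> means that \<open>z\<close> is real and nonnegative.\<close>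

definition positive_op :: "nat \<Rightarrow> complex mat \<Rightarrow> bool" where
  "positive_op n A \<longleftrightarrow>
     A \<in> carrier_mat n n \<and> (\<forall>v\<in>carrier_vec n. 0 \<le> (A *\<^sub>v v) \<bullet>c v)"

definition ket_bra :: "complex vec \<Rightarrow> complex mat" where
  "ket_bra v = mat (dim_vec v) (dim_vec v) (\<lambda>(i, j). v $ i * cnj (v $ j))"

definition mat_exp :: "complex mat \<Rightarrow> complex mat" where
  "mat_exp A = mat (dim_row A) (dim_row A)
     (\<lambda>(i, j). \<Sum>k. (A ^\<^sub>m k) $$ (i, j) / fact k)"

definition evolved :: "complex mat \<Rightarrow> complex vec \<Rightarrow> real \<Rightarrow> complex vec" where
  "evolved H \<psi> t = mat_exp ((- \<i> * complex_of_real t) \<cdot>\<^sub>m H) *\<^sub>v \<psi>"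


definition kron_vec :: "complex vec \<Rightarrow> complex vec \<Rightarrow> complex vec" where
  "kron_vec u v = vec (dim_vec u * dim_vec v)
     (\<lambda>i. u $ (i div dim_vec v) * v $ (i mod dim_vec v))"

definition kron_mat :: "complex mat \<Rightarrow> complex mat \<Rightarrow> complex mat" where
  "kron_mat A B = mat (dim_row A * dim_row B) (dim_col A * dim_col B)
     (\<lambda>(i, j). A $$ (i div dim_row B, j div dim_col B) *
               B $$ (i mod dim_row B, j mod dim_col B))"

primrec kron_vec_pow :: "complex vec \<Rightarrow> nat \<Rightarrow> complex vec" where
  "kron_vec_pow v 0 = vec 1 (\<lambda>_. 1)"
| "kron_vec_pow v (Suc n) = kron_vec v (kron_vec_pow v n)"

primrec kron_mat_pow :: "complex mat \<Rightarrow> nat \<Rightarrow> complex mat" where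
  "kron_mat_pow A 0 = 1\<^sub>m 1"
| "kron_mat_pow A (Suc n) = kron_mat A (kron_mat_pow A n)"


text \<open>
  Maps between operator spaces are functions on all matrices of which only the values on
  \<open>carrier_mat n n\<close> matter.
\<close>

definition linear_op_map :: "nat \<Rightarrow> nat \<Rightarrow> (complex mat \<Rightarrow> complex mat) \<Rightarrow> bool" where
  "linear_op_map n m P \<longleftrightarrow>
     (\<forall>A\<in>carrier_mat n n. P A \<in> carrier_mat m m) \<and>
     (\<forall>A\<in>carrier_mat n n. \<forall>B\<in>carrier_mat n n. P (A + B) = P A + P B) \<and>
     (\<forall>a. \<forall>A\<in>carrier_mat n n. P (a \<cdot>\<^sub>m A) = a \<cdot>\<^sub>m P A)"

text \<open>
  \<open>ampliation k n m P\<close> is the map \<open>id \<otimes> P\<close>, with \<open>id\<close> on the \<open>k \<times> k\<close> matrices: it applies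
  \<open>P\<close> to each of the \<open>n \<times> n\<close> blocks of its argument (see \<open>ampliation_kron_mat\<close> below).
\<close>

definition mat_block :: "nat \<Rightarrow> complex mat \<Rightarrow> nat \<Rightarrow> nat \<Rightarrow> complex mat" where
  "mat_block n X i j = mat n n (\<lambda>(a, b). X $$ (i * n + a, j * n + b))"

definition ampliation ::
  "nat \<Rightarrow> nat \<Rightarrow> nat \<Rightarrow> (complex mat \<Rightarrow> complex mat) \<Rightarrow> complex mat \<Rightarrow> complex mat" where
  "ampliation k n m P X = mat (k * m) (k * m)
     (\<lambda>(r, s). P (mat_block n X (r div m) (s div m)) $$ (r mod m, s mod m))"

lemma div_less_of_less_mult: "r div m < k" if "r < k * m" for r k m :: nat
  using that by (simp add: less_mult_imp_div_less)

lemma mat_block_kron_mat: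
  assumes "A \<in> carrier_mat k k" "B \<in> carrier_mat n n" "i < k" "j < k"
  shows "mat_block n (kron_mat A B) i j = A $$ (i, j) \<cdot>\<^sub>m B"
proof -
  have "i * n + a < k * n" if "i < k" "a < n" for i a
  proof -
    have "i * n + a < Suc i * n" using that by simp
    also have "\<dots> \<le> k * n" using that by (intro mult_le_mono1) simp
    finally show ?thesis .
  qed
  then show ?thesis
    using assms by (intro eq_matI) (auto simp: mat_block_def kron_mat_def)
qed

lemma ampliation_kron_mat:
  assumes "linear_op_map n m P" "A \<in> carrier_mat k k" "B \<in> carrier_mat n n"
  shows "ampliation k n m P (kron_mat A B) = kron_mat A (P B)"
proof -
  have PB: "P B \<in> carrier_mat m m"
    using assms by (auto simp: linear_op_map_def)
  have sm: "P (a \<cdot>\<^sub>m B) = a \<cdot>\<^sub>m P B" for a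
    using assms by (auto simp: linear_op_map_def)
  show ?thesis
  proof (rule eq_matI)
    fix r s assume "r < dim_row (kron_mat A (P B))" "s < dim_col (kron_mat A (P B))"
    then have r: "r < k * m" and s: "s < k * m"
      using assms PB by (auto simp: kron_mat_def)
    then have m: "m > 0" by (cases m) auto
    show "ampliation k n m P (kron_mat A B) $$ (r, s) = kron_mat A (P B) $$ (r, s)"
      using r s m PB assms(2,3) div_less_of_less_mult[OF r] div_less_of_less_mult[OF s]
      by (simp add: ampliation_def mat_block_kron_mat sm, simp add: kron_mat_def)
  qed (use assms PB in \<open>auto simp: ampliation_def kron_mat_def\<close>)
qed

definition completely_positive ::
  "nat \<Rightarrow> nat \<Rightarrow> (complex mat \<Rightarrow> complex mat) \<Rightarrow> bool" where
  "completely_positive n m P \<longleftrightarrow>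
     (\<forall>k X. positive_op (k * n) X \<longrightarrow> positive_op (k * m) (ampliation k n m P X))"

definition trace_nonincreasing :: "nat \<Rightarrow> (complex mat \<Rightarrow> complex mat) \<Rightarrow> bool" where
  "trace_nonincreasing n P \<longleftrightarrow>
     (\<forall>X. positive_op n X \<longrightarrow> mat_trace (P X) \<le> mat_trace X)"


text \<open>
  In the following, \<open>\<phi>\<close> is the family of states \<open>t \<mapsto> |\<psi>\<^sub>t\<rangle>\<close> in dimension \<open>d\<close>, to be
  replicated from \<open>N\<close> to \<open>M\<close> copies.
\<close>

definition success_weight ::
  "(real \<Rightarrow> complex vec) \<Rightarrow> nat \<Rightarrow> (complex mat \<Rightarrow> complex mat) \<Rightarrow> real \<Rightarrow> complex" where
  "success_weight \<phi> N P t = mat_trace (P (kron_mat_pow (ket_bra (\<phi> t)) N))"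

definition replication_process ::
  "nat \<Rightarrow> (real \<Rightarrow> complex vec) \<Rightarrow> nat \<Rightarrow> nat \<Rightarrow> (complex mat \<Rightarrow> complex mat) \<Rightarrow> bool" where
  "replication_process d \<phi> N M P \<longleftrightarrow>
     linear_op_map (d ^ N) (d ^ M) P \<and>
     completely_positive (d ^ N) (d ^ M) P \<and>
     trace_nonincreasing (d ^ N) P \<and>
     (\<exists>t. success_weight \<phi> N P t \<noteq> 0)"

text \<open>
  For a replication process the quotient is a nonnegative real, so that \<open>Re\<close> only changes the
  type, and the infimum is over a nonempty set that is bounded below.
\<close>

definition replication_fidelity ::
  "(real \<Rightarrow> complex vec) \<Rightarrow> nat \<Rightarrow> nat \<Rightarrow> (complex mat \<Rightarrow> complex mat) \<Rightarrow> real" where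
  "replication_fidelity \<phi> N M P =
     (INF t\<in>{t. success_weight \<phi> N P t \<noteq> 0}.
        Re (((P (kron_mat_pow (ket_bra (\<phi> t)) N) *\<^sub>v kron_vec_pow (\<phi> t) M)
               \<bullet>c kron_vec_pow (\<phi> t) M)
            / success_weight \<phi> N P t))"

end

theory Submission
  imports Defs
begin

text \<open>
  Decompose \<open>|\<psi>\<^sub>t\<rangle>\<^sup>\<otimes>\<^sup>N = \<Sum>E. exp (- i t E) A E\<close> and \<open>|\<psi>\<^sub>t\<rangle>\<^sup>\<otimes>\<^sup>M = \<Sum>E. exp (- i t E) b E\<close>
  into energy components. Multiplying the definition of the fidelity \<open>F\<close> by its denominator and
  taking the mean over all times \<open>t\<close> leaves only resonant terms. Complete positivity makes the
  block operator \<open>Y = [P (|A E\<rangle>\<langle>A E'|)]\<close> positive; the mean of the denominator is its trace, and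
  the mean of the numerator is \<open>\<Sum>w. \<langle>B w|Y|B w\<rangle>\<close> with the orthogonal vectors
  \<open>B w = \<Sum>E. |E\<rangle> \<otimes> b (E + w)\<close>. Hence \<open>F\<close> is at most the largest squared norm of a \<open>B w\<close>, a bound
  that does not involve the success probability. This squared norm is the probability that the
  total energy of \<open>M\<close> copies, a sum of \<open>M\<close> independent nonconstant random variables, lies in a
  translate of the energy spectrum of \<open>N\<close> copies and thus in an interval of length \<open>O(N)\<close>.
  Since that sum spreads over the scale \<open>\<surd>M\<close>, which is much larger than \<open>N\<close>, the probability
  tends to 0.
\<close>


section \<open>Means of trigonometric sums and anticoncentration\<close>

lemma cesaro_cis_tendsto_0:
  assumes "cis \<theta> \<noteq> 1"
  shows "(\<lambda>n. (\<Sum>j<n. cis (\<theta> * real j)) / of_nat n) \<longlonglongrightarrow> 0"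
proof (rule tendsto_0_le)
  have cisj: "cis (\<theta> * real j) = cis \<theta> ^ j" for j
    by (metis DeMoivre mult.commute)
  show "\<forall>\<^sub>F n in sequentially.
      norm ((\<Sum>j<n. cis (\<theta> * real j)) / of_nat n) \<le> norm (1 / real n) * (2 / norm (1 - cis \<theta>))"
  proof (rule always_eventually, rule allI)
    fix n
    \<comment> \<open>The geometric sum stays bounded by \<open>2 / norm (1 - cis \<theta>)\<close>
      for all \<open>n\<close>, so division by \<open>n\<close> sends it to 0.\<close>
    have "norm (1 - cis \<theta> ^ n) \<le> norm (1::complex) + norm (cis \<theta> ^ n)"
      by (rule norm_triangle_ineq4)
    also have "\<dots> = 2" by (simp add: norm_power)
    finally have "norm (1 - cis \<theta> ^ n) \<le> 2" .
    then have "norm (1 - cis \<theta> ^ n) / norm (1 - cis \<theta>) / real n \<le> 2 / norm (1 - cis \<theta>) / real n"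
      by (intro divide_right_mono) auto
    moreover have "(\<Sum>j<n. cis (\<theta> * real j)) = (1 - cis \<theta> ^ n) / (1 - cis \<theta>)"
      using assms by (simp add: cisj sum_gp_strict)
    ultimately show "norm ((\<Sum>j<n. cis (\<theta> * real j)) / of_nat n)
        \<le> norm (1 / real n) * (2 / norm (1 - cis \<theta>))"
      by (simp add: norm_divide norm_mult mult.commute)
  qed
  show "(\<lambda>n. 1 / real n) \<longlonglongrightarrow> 0"
    by (rule lim_1_over_n)
qed

lemma cis_neq_1_if_small:
  assumes "\<theta> \<noteq> 0" "\<bar>\<theta>\<bar> < 1"
  shows "cis \<theta> \<noteq> 1"
proof
  assume "cis \<theta> = 1"
  then have "sin \<theta> = 0" by (metis cis.sel(2) one_complex.sel(2))
  moreover have "sin \<bar>\<theta>\<bar> > 0"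
    using assms pi_ge_two by (intro sin_gt_zero) auto
  ultimately show False by (auto simp: abs_if split: if_splits)
qed

text \<open>One sampling step has to serve all frequencies in \<open>D\<close> at once. It is taken
  so small that \<open>\<bar>x * \<tau>\<bar> < 1\<close>; then no nonzero frequency is aliased to
  0, and sampled means detect resonance as continuous time means do.\<close>

lemma sampled_mean_characters:
  assumes "finite D"
  shows "\<exists>\<tau>::real. \<forall>x\<in>D. (\<lambda>n. (\<Sum>j<n. cis (x * (\<tau> * real j))) / of_nat n) \<longlonglongrightarrow> (if x = 0 then 1 else 0)"
proof -
  define \<tau> where "\<tau> = 1 / (1 + (\<Sum>x\<in>D. \<bar>x\<bar>))"
  have pos: "0 < 1 + (\<Sum>x\<in>D. \<bar>x\<bar>)"
    by (rule add_pos_nonneg) (auto intro: sum_nonneg)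
  have "(\<lambda>n. (\<Sum>j<n. cis (x * (\<tau> * real j))) / of_nat n) \<longlonglongrightarrow> (if x = 0 then 1 else 0)"
    if x: "x \<in> D" for x
  proof (cases "x = 0")
    case True
    have "(\<lambda>n. of_nat n / of_nat n :: complex) \<longlonglongrightarrow> 1"
      by (rule tendsto_eventually) (auto intro: eventually_sequentiallyI[of 1])
    then show ?thesis using True by simp
  next
    case False
    have "\<bar>x\<bar> \<le> (\<Sum>x\<in>D. \<bar>x\<bar>)" by (rule member_le_sum[OF x]) (use assms in auto)
    then have "\<bar>x * \<tau>\<bar> < 1" using pos by (simp add: \<tau>_def abs_mult)
    moreover have "x * \<tau> \<noteq> 0" using False pos by (simp add: \<tau>_def)
    ultimately have "cis (x * \<tau>) \<noteq> 1" by (intro cis_neq_1_if_small)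
    from cesaro_cis_tendsto_0[OF this] show ?thesis using False by (simp add: mult.assoc)
  qed
  then show ?thesis by blast
qed

lemma sampled_mean_trig_sum:
  assumes "finite A"
    and "\<And>a. a \<in> A \<Longrightarrow>
      (\<lambda>n. (\<Sum>j<n. cis (x a * (\<tau> * real j))) / of_nat n) \<longlonglongrightarrow> (if x a = 0 then 1 else 0)"
  shows "(\<lambda>n. Re ((\<Sum>j<n. \<Sum>a\<in>A. c a * cis (x a * (\<tau> * real j))) / of_nat n)) \<longlonglongrightarrow>
    Re (\<Sum>a | a \<in> A \<and> x a = 0. c a)"
proof -
  have "(\<lambda>n. \<Sum>a\<in>A. c a * ((\<Sum>j<n. cis (x a * (\<tau> * real j))) / of_nat n)) \<longlonglongrightarrow>
      (\<Sum>a\<in>A. c a * (if x a = 0 then 1 else 0))"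
    by (intro tendsto_sum tendsto_mult_left assms)
  moreover have "(\<Sum>a\<in>A. c a * (if x a = 0 then 1 else 0)) = (\<Sum>a | a \<in> A \<and> x a = 0. c a)"
    using assms(1) by (simp add: sum.If_cases Int_def if_distrib cong: if_cong)
  moreover have "(\<Sum>a\<in>A. c a * ((\<Sum>j<n. cis (x a * (\<tau> * real j))) / of_nat n)) =
      (\<Sum>j<n. \<Sum>a\<in>A. c a * cis (x a * (\<tau> * real j))) / of_nat n" for n
    by (subst sum.swap) (simp add: sum_divide_distrib sum_distrib_left)
  ultimately show ?thesis by (intro tendsto_Re) simp
qed

text \<open>An inequality valid at every time survives averaging, and averaging keeps exactly the
  terms of frequency 0. Sampling both sides with the same step makes the two limits
  comparable.\<close>

lemma trig_sum_mean_mono: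
  fixes x :: "'a \<Rightarrow> real" and y :: "'b \<Rightarrow> real"
  assumes fin: "finite A" "finite B"
    and le: "\<And>t. Re (\<Sum>a\<in>A. c a * cis (x a * t)) \<le> Re (\<Sum>b\<in>B. e b * cis (y b * t))"
  shows "Re (\<Sum>a | a \<in> A \<and> x a = 0. c a) \<le> Re (\<Sum>b | b \<in> B \<and> y b = 0. e b)"
proof -
  obtain \<tau> where \<tau>: "\<And>z. z \<in> x ` A \<union> y ` B \<Longrightarrow>
      (\<lambda>n. (\<Sum>j<n. cis (z * (\<tau> * real j))) / of_nat n) \<longlonglongrightarrow> (if z = 0 then 1 else 0)"
    using sampled_mean_characters[of "x ` A \<union> y ` B"] fin by auto
  show ?thesis
  proof (rule tendsto_le[OF sequentially_bot])
    show "(\<lambda>n. Re ((\<Sum>j<n. \<Sum>a\<in>A. c a * cis (x a * (\<tau> * real j))) / of_nat n)) \<longlonglongrightarrow>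
        Re (\<Sum>a | a \<in> A \<and> x a = 0. c a)"
      by (rule sampled_mean_trig_sum[OF fin(1)]) (rule \<tau>, blast)
    show "(\<lambda>n. Re ((\<Sum>j<n. \<Sum>b\<in>B. e b * cis (y b * (\<tau> * real j))) / of_nat n)) \<longlonglongrightarrow>
        Re (\<Sum>b | b \<in> B \<and> y b = 0. e b)"
      by (rule sampled_mean_trig_sum[OF fin(2)]) (rule \<tau>, blast)
    show "\<forall>\<^sub>F n in sequentially. Re ((\<Sum>j<n. \<Sum>a\<in>A. c a * cis (x a * (\<tau> * real j))) / of_nat n)
        \<le> Re ((\<Sum>j<n. \<Sum>b\<in>B. e b * cis (y b * (\<tau> * real j))) / of_nat n)"
      unfolding Re_divide_of_nat Re_sum[of _ "{..<_}"]
      by (intro always_eventually allI divide_right_mono sum_mono le) simp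
  qed
qed

section \<open>Anticoncentration from the decay of a characteristic function\<close>

lemma cos_ge_quadratic: "1 - x\<^sup>2 / 2 \<le> cos x" for x :: real
proof -
  have "(sin (x/2))\<^sup>2 \<le> (x/2)\<^sup>2"
    using abs_sin_x_le_abs_x[of "x/2"] abs_le_square_iff by blast
  then show ?thesis
    using cos_double_sin[of "x/2"] by (simp add: power2_eq_square)
qed

lemma cos_le_quadratic:
  fixes x :: real
  assumes "\<bar>x\<bar> \<le> 1"
  shows "cos x \<le> 1 - x\<^sup>2 / 8"
proof -
  \<comment> \<open>The derivative \<open>cos z - 1 / 2\<close> is nonnegative on the unit interval.
    Inserted at \<open>x / 2\<close> in \<open>cos x = 1 - 2 * (sin (x / 2))\<^sup>2\<close>, this
    gives the constant 1/8.\<close>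
  have sin: "y / 2 \<le> sin y" if "0 \<le> y" "y \<le> 1" for y :: real
  proof -
    have "sin 0 - 0 / 2 \<le> sin y - y / 2"
    proof (rule DERIV_nonneg_imp_nondecreasing[where f = "\<lambda>y. sin y - y / 2", OF that(1)])
      fix z :: real assume z: "0 \<le> z" "z \<le> y"
      have "z\<^sup>2 \<le> 1" using z that by (simp add: abs_square_le_1)
      then have "0 \<le> cos z - 1 / 2" using cos_ge_quadratic[of z] by simp
      moreover have "((\<lambda>y. sin y - y / 2) has_real_derivative cos z - 1 / 2) (at z)"
        by (auto intro!: derivative_eq_intros)
      ultimately show "\<exists>y. ((\<lambda>y. sin y - y / 2) has_real_derivative y) (at z) \<and> 0 \<le> y" by blast
    qed
    then show ?thesis by simp
  qed
  have "x\<^sup>2 / 16 \<le> (sin (x / 2))\<^sup>2"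
  proof -
    have "\<bar>x\<bar> / 4 \<le> sin (\<bar>x\<bar> / 2)" using sin[of "\<bar>x\<bar> / 2"] assms by simp
    then have "(\<bar>x\<bar> / 4)\<^sup>2 \<le> (sin (\<bar>x\<bar> / 2))\<^sup>2" by (intro power_mono) auto
    moreover have "(sin (\<bar>x\<bar> / 2))\<^sup>2 = (sin (x / 2))\<^sup>2" by (auto simp: abs_if)
    ultimately show ?thesis by (simp add: power_divide)
  qed
  then show ?thesis using cos_double_sin[of "x/2"] by simp
qed

text \<open>The squared modulus is the characteristic function of the difference of two independent
  copies. In its defect from 1, namely the sum of
  \<open>p l * p m * (1 - cos ((l - m) * t))\<close>, all terms are nonnegative, and the pair
  \<open>(a, b)\<close> alone already gives a quadratic lower bound near 0.\<close>

lemma characteristic_function_decay: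
  fixes p :: "real \<Rightarrow> real"
  assumes fin: "finite \<Lambda>" and p0: "\<And>l. l \<in> \<Lambda> \<Longrightarrow> 0 \<le> p l" and p1: "(\<Sum>l\<in>\<Lambda>. p l) = 1"
    and ab: "a \<in> \<Lambda>" "b \<in> \<Lambda>" "a \<noteq> b" "0 < p a" "0 < p b"
  shows "\<exists>k>0. \<exists>T>0. \<forall>t. \<bar>t\<bar> \<le> T \<longrightarrow> norm (\<Sum>l\<in>\<Lambda>. of_real (p l) * cis (l * t)) \<le> exp (- (k * t\<^sup>2))"
proof -
  \<comment> \<open>The 16 is the 8 of \<open>cos_le_quadratic\<close> times the 2 lost in passing
    from the squared norm to the norm.\<close>
  define k where "k = p a * p b * (a - b)\<^sup>2 / 16"
  have k: "0 < k" using ab by (simp add: k_def)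
  have bound: "norm (\<Sum>l\<in>\<Lambda>. of_real (p l) * cis (l * t)) \<le> exp (- (k * t\<^sup>2))"
    if t: "\<bar>t\<bar> \<le> 1 / \<bar>a - b\<bar>" for t
  proof -
    define z where "z = (\<Sum>l\<in>\<Lambda>. of_real (p l) * cis (l * t))"
    have "complex_of_real ((norm z)\<^sup>2) = z * cnj z" by (rule complex_norm_square)
    also have "\<dots> = (\<Sum>l\<in>\<Lambda>. \<Sum>m\<in>\<Lambda>. of_real (p l * p m) * cis ((l - m) * t))"
      unfolding z_def cnj_sum sum_product
      by (intro sum.cong refl) (simp add: cis_cnj cis_mult algebra_simps)
    finally have "Re (complex_of_real ((norm z)\<^sup>2)) =
        Re (\<Sum>l\<in>\<Lambda>. \<Sum>m\<in>\<Lambda>. of_real (p l * p m) * cis ((l - m) * t))"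
      by simp
    then have z2: "(norm z)\<^sup>2 = (\<Sum>l\<in>\<Lambda>. \<Sum>m\<in>\<Lambda>. p l * p m * cos ((l - m) * t))"
      by simp
    have one: "(\<Sum>l\<in>\<Lambda>. \<Sum>m\<in>\<Lambda>. p l * p m) = 1"
      using p1 by (simp flip: sum_product)
    have "2 * (k * t\<^sup>2) = p a * p b * (((a - b) * t)\<^sup>2 / 8)"
      by (simp add: k_def power_mult_distrib)
    also have "\<dots> \<le> p a * p b * (1 - cos ((a - b) * t))"
    proof (rule mult_left_mono)
      have "\<bar>(a - b) * t\<bar> = \<bar>t\<bar> * \<bar>a - b\<bar>" by (simp only: abs_mult mult.commute)
      then have "\<bar>(a - b) * t\<bar> \<le> 1" using t ab by (simp add: field_simps)
      then show "((a - b) * t)\<^sup>2 / 8 \<le> 1 - cos ((a - b) * t)"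
        using cos_le_quadratic[of "(a - b) * t"] by simp
    qed (use ab in simp)
    also have "\<dots> \<le> (\<Sum>m\<in>\<Lambda>. p a * p m * (1 - cos ((a - m) * t)))"
      by (rule member_le_sum[OF ab(2) _ fin, where f = "\<lambda>m. p a * p m * (1 - cos ((a - m) * t))"])
        (intro mult_nonneg_nonneg p0 ab, auto)
    also have "\<dots> \<le> (\<Sum>l\<in>\<Lambda>. \<Sum>m\<in>\<Lambda>. p l * p m * (1 - cos ((l - m) * t)))"
      by (rule member_le_sum[OF ab(1) _ fin, where f = "\<lambda>l. \<Sum>m\<in>\<Lambda>. p l * p m * (1 - cos ((l - m) * t))"])
        (intro sum_nonneg mult_nonneg_nonneg p0, auto)
    also have "\<dots> = 1 - (norm z)\<^sup>2"
      using one by (simp add: z2 right_diff_distrib sum_subtractf)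
    finally have "(norm z)\<^sup>2 \<le> 1 + - (2 * (k * t\<^sup>2))" by simp
    also have "\<dots> \<le> exp (- (2 * (k * t\<^sup>2)))" by (rule exp_ge_add_one_self)
    also have "\<dots> = (exp (- (k * t\<^sup>2)))\<^sup>2" by (simp add: power2_eq_square flip: exp_add)
    finally show ?thesis unfolding z_def by (rule power2_le_imp_le) simp
  qed
  have "0 < 1 / \<bar>a - b\<bar>" using ab by simp
  with k bound show ?thesis by blast
qed

text \<open>A discrete form of Esseen's inequality, with the Fejer kernel
  \<open>\<bar>\<Sum>j<n. cis (\<tau> j y)\<bar>\<^sup>2\<close> as a majorant of the indicator of an interval.\<close>

lemma concentration_le_fejer:
  fixes \<mu> :: "real \<Rightarrow> real"
  assumes fin: "finite S" and \<mu>: "\<And>F. F \<in> S \<Longrightarrow> 0 \<le> \<mu> F" and \<tau>: "0 \<le> \<tau>" "\<tau> * L * real n \<le> 1"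
  shows "(real n)\<^sup>2 / 4 * (\<Sum>F | F \<in> S \<and> \<bar>F - x\<bar> \<le> L. \<mu> F) \<le>
    (\<Sum>j<n. \<Sum>k<n. norm (\<Sum>F\<in>S. of_real (\<mu> F) * cis (F * ((real j - real k) * \<tau>))))"
proof -
  define D where "D y = (\<Sum>j<n. cis (real j * \<tau> * y))" for y
  \<comment> \<open>On the window every phase \<open>real j * \<tau> * y\<close> is at most 1 in
    modulus, so each cosine is at least 1/2 and nothing cancels in the sum.\<close>
  have D: "(real n / 2)\<^sup>2 \<le> (norm (D y))\<^sup>2" if y: "\<bar>y\<bar> \<le> L" for y
  proof (rule power_mono)
    have c: "1 / 2 \<le> cos (real j * \<tau> * y)" if "j < n" for j
    proof -
      have "\<bar>real j * \<tau> * y\<bar> = real j * (\<tau> * \<bar>y\<bar>)" using \<tau> by (simp add: abs_mult)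
      also have "\<dots> \<le> real n * (\<tau> * L)"
        using that y \<tau> by (intro mult_mono mult_nonneg_nonneg) auto
      finally have "\<bar>real j * \<tau> * y\<bar> \<le> 1" using \<tau> by (simp add: mult.commute mult.left_commute)
      then have "(real j * \<tau> * y)\<^sup>2 \<le> 1" by (simp add: abs_square_le_1)
      then show ?thesis using cos_ge_quadratic[of "real j * \<tau> * y"] by simp
    qed
    have "real n / 2 = (\<Sum>j<n. 1 / 2)" by simp
    also have "\<dots> \<le> (\<Sum>j<n. cos (real j * \<tau> * y))" by (rule sum_mono) (use c in auto)
    also have "\<dots> = Re (D y)" by (simp add: D_def)
    also have "\<dots> \<le> norm (D y)" by (rule complex_Re_le_cmod)
    finally show "real n / 2 \<le> norm (D y)" .
  qed simp
  have D2: "complex_of_real ((norm (D y))\<^sup>2) = (\<Sum>j<n. \<Sum>k<n. cis (y * ((real j - real k) * \<tau>)))" for y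
    unfolding complex_norm_square D_def cnj_sum sum_product
    by (intro sum.cong refl) (simp add: cis_cnj cis_mult algebra_simps)
  have "(real n)\<^sup>2 / 4 * (\<Sum>F | F \<in> S \<and> \<bar>F - x\<bar> \<le> L. \<mu> F) =
      (\<Sum>F | F \<in> S \<and> \<bar>F - x\<bar> \<le> L. \<mu> F * (real n / 2)\<^sup>2)"
    by (simp add: sum_distrib_left power_divide mult.commute)
  also have "\<dots> \<le> (\<Sum>F | F \<in> S \<and> \<bar>F - x\<bar> \<le> L. \<mu> F * (norm (D (F - x)))\<^sup>2)"
    by (intro sum_mono mult_left_mono D) (use \<mu> in auto)
  also have "\<dots> \<le> (\<Sum>F\<in>S. \<mu> F * (norm (D (F - x)))\<^sup>2)"
    by (rule sum_mono2) (use fin \<mu> in auto)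
  also have "\<dots> = Re (\<Sum>F\<in>S. of_real (\<mu> F) * complex_of_real ((norm (D (F - x)))\<^sup>2))"
    by simp
  \<comment> \<open>Expanding the kernel turns the sum over \<open>F\<close> into values of the
    characteristic function at the times \<open>(real j - real k) * \<tau>\<close>. The centre
    \<open>x\<close> contributes only phases of modulus 1, so the bound is uniform in
    \<open>x\<close>.\<close>
  also have "(\<Sum>F\<in>S. of_real (\<mu> F) * complex_of_real ((norm (D (F - x)))\<^sup>2)) =
      (\<Sum>F\<in>S. \<Sum>j<n. \<Sum>k<n. cis (- x * ((real j - real k) * \<tau>)) *
        (of_real (\<mu> F) * cis (F * ((real j - real k) * \<tau>))))"
    unfolding D2 sum_distrib_left
    by (intro sum.cong refl) (simp add: cis_mult algebra_simps)
  also have "\<dots> = (\<Sum>j<n. \<Sum>k<n. cis (- x * ((real j - real k) * \<tau>)) *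
      (\<Sum>F\<in>S. of_real (\<mu> F) * cis (F * ((real j - real k) * \<tau>))))"
    by (subst sum.swap, rule sum.cong[OF refl], subst sum.swap) (simp add: sum_distrib_left)
  also have "Re \<dots> \<le> norm \<dots>" by (rule complex_Re_le_cmod)
  also have "\<dots> \<le> (\<Sum>j<n. \<Sum>k<n. norm (cis (- x * ((real j - real k) * \<tau>)) *
      (\<Sum>F\<in>S. of_real (\<mu> F) * cis (F * ((real j - real k) * \<tau>)))))"
    by (intro order_trans[OF norm_sum] sum_mono order_refl)
  finally show ?thesis by (simp add: norm_mult)
qed

text \<open>In the Fejer bound with step \<open>1 / (n * L)\<close>, the \<open>n\<close> diagonal
  pairs contribute at most \<open>1 + B\<close> each. Every other pair has a time of modulus at
  least one step and contributes at most \<open>B\<close>, the \<open>M\<close>-th power of the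
  Gaussian bound at one step. The assumption \<open>1 / T \<le> L\<close> keeps all times in the
  range of \<open>decay\<close>. The kernel order \<open>n\<close> stays free, to be fixed before
  \<open>M\<close> grows.\<close>

lemma concentration_bound:
  fixes \<mu> :: "real \<Rightarrow> real"
  assumes fin: "finite S" and \<mu>: "\<And>F. F \<in> S \<Longrightarrow> 0 \<le> \<mu> F"
    and n: "n \<ge> 1" and L: "0 < L" "1 / T \<le> L" "0 < T" and k: "0 < k"
    and char: "\<And>t. (\<Sum>F\<in>S. of_real (\<mu> F) * cis (F * t)) = \<phi> t ^ M"
    and decay: "\<And>t. \<bar>t\<bar> \<le> T \<Longrightarrow> norm (\<phi> t) \<le> exp (- (k * t\<^sup>2))"
  shows "(\<Sum>F | F \<in> S \<and> \<bar>F - x\<bar> \<le> L. \<mu> F) \<le>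
    4 / real n + 4 * exp (- (k * real M / (real n * L)\<^sup>2))"
proof -
  define \<tau> where "\<tau> = 1 / (real n * L)"
  define B where "B = exp (- (k * real M / (real n * L)\<^sup>2))"
  have tau0: "0 < \<tau>" and tau1: "\<tau> * L * real n = 1" using n L by (auto simp: \<tau>_def)
  have term_bound: "norm (\<phi> ((real i - real j) * \<tau>) ^ M) \<le> (if i = j then 1 else 0) + B"
    if ij: "i < n" "j < n" for i j
  proof -
    define t where "t = (real i - real j) * \<tau>"
    have "\<bar>t\<bar> \<le> real n * \<tau>"
      unfolding t_def abs_mult using ij tau0 by (intro mult_mono) auto
    also have "\<dots> = 1 / L" using n by (simp add: \<tau>_def)
    also have "\<dots> \<le> T" using L by (simp add: field_simps)
    finally have "norm (\<phi> t) ^ M \<le> exp (- (k * t\<^sup>2)) ^ M"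
      by (intro power_mono decay) auto
    also have "\<dots> = exp (- (k * real M * t\<^sup>2))" by (simp flip: exp_of_nat_mult)
    also have "\<dots> \<le> (if i = j then 1 else 0) + B"
    proof (cases "i = j")
      case True
      then show ?thesis by (simp add: t_def B_def)
    next
      case False
      then have "1 \<le> \<bar>real i - real j\<bar>" by linarith
      then have "1 * \<tau> \<le> \<bar>t\<bar>" unfolding t_def abs_mult using tau0 by (intro mult_mono) auto
      then have "\<tau>\<^sup>2 \<le> t\<^sup>2" using tau0 by (simp add: abs_le_square_iff[symmetric])
      then have "k * real M * \<tau>\<^sup>2 \<le> k * real M * t\<^sup>2"
        using k by (intro mult_left_mono) auto
      moreover have "k * real M * \<tau>\<^sup>2 = k * real M / (real n * L)\<^sup>2"
        by (simp add: \<tau>_def power_divide)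
      ultimately show ?thesis using False by (simp add: B_def)
    qed
    finally show ?thesis by (simp add: t_def norm_power)
  qed
  have "(real n)\<^sup>2 / 4 * (\<Sum>F | F \<in> S \<and> \<bar>F - x\<bar> \<le> L. \<mu> F)
      \<le> (\<Sum>i<n. \<Sum>j<n. norm (\<phi> ((real i - real j) * \<tau>) ^ M))"
    using concentration_le_fejer[where \<mu> = \<mu> and \<tau> = \<tau> and L = L and n = n and x = x, OF fin \<mu>] tau0 tau1 by (simp add: char)
  also have "\<dots> \<le> (\<Sum>i<n. \<Sum>j<n. (if i = j then 1 else 0) + B)"
    by (intro sum_mono term_bound) auto
  also have "\<dots> = real n + (real n)\<^sup>2 * B"
    by (simp add: sum.distrib power2_eq_square algebra_simps)
  finally have "(\<Sum>F | F \<in> S \<and> \<bar>F - x\<bar> \<le> L. \<mu> F) \<le> (real n + (real n)\<^sup>2 * B) / ((real n)\<^sup>2 / 4)"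
    using n by (simp add: field_simps)
  also have "\<dots> = 4 / real n + 4 * B" using n by (simp add: field_simps power2_eq_square)
  finally show ?thesis by (simp add: B_def)
qed


section \<open>Energy components of tensor powers\<close>

lemma sum_div_mod:
  fixes f :: "nat \<Rightarrow> nat \<Rightarrow> 'a::comm_monoid_add"
  shows "(\<Sum>r<k * m. f (r div m) (r mod m)) = (\<Sum>i<k. \<Sum>a<m. f i a)"
proof -
  have "(\<Sum>r<k * m. f (r div m) (r mod m)) =
      (\<Sum>i<k. \<Sum>r\<in>{i * m..<i * m + m}. f (r div m) (r mod m))"
    by (rule sum.nat_group[symmetric])
  also have "\<dots> = (\<Sum>i<k. \<Sum>a<m. f i a)"
  proof (rule sum.cong[OF refl])
    fix i
    have "(\<Sum>r\<in>{i * m..<i * m + m}. f (r div m) (r mod m)) =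
        (\<Sum>a\<in>{0..<m}. f ((a + i * m) div m) ((a + i * m) mod m))"
      using sum.shift_bounds_nat_ivl[of "\<lambda>r. f (r div m) (r mod m)" 0 "i * m" m]
      by (simp add: add.commute)
    also have "\<dots> = (\<Sum>a<m. f i a)"
      unfolding atLeast0LessThan by (intro sum.cong) auto
    finally show "(\<Sum>r\<in>{i * m..<i * m + m}. f (r div m) (r mod m)) = (\<Sum>a<m. f i a)" .
  qed
  finally show ?thesis .
qed

text \<open>This is the change of variables in a convolution. Any \<open>T\<close> containing the
  shifted support will do, which allows sums over different \<open>l\<close> to be brought to a
  common range.\<close>

lemma sum_shift_support:
  fixes f h :: "real \<Rightarrow> 'a::semiring_0"
  assumes "finite S" "finite T" "(\<lambda>E. E + l) ` S \<subseteq> T" "\<And>E. E \<notin> S \<Longrightarrow> f E = 0"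
  shows "(\<Sum>E\<in>T. h E * f (E - l)) = (\<Sum>E\<in>S. h (E + l) * f E)"
proof -
  have "(\<Sum>E\<in>T. h E * f (E - l)) = (\<Sum>E\<in>(\<lambda>E. E + l) ` S. h E * f (E - l))"
  proof (rule sum.mono_neutral_right)
    show "\<forall>E\<in>T - (\<lambda>E. E + l) ` S. h E * f (E - l) = 0"
    proof
      fix E assume E: "E \<in> T - (\<lambda>E. E + l) ` S"
      then have "E - l \<notin> S" by (metis DiffE diff_add_cancel imageI)
      then show "h E * f (E - l) = 0" using assms(4) by simp
    qed
  qed (use assms in auto)
  also have "\<dots> = (\<Sum>E\<in>S. h (E + l) * f E)"
    by (subst sum.reindex) (auto simp: inj_on_def)
  finally show ?thesis .
qed

lemma kron_vec_pow_dim [simp]: "dim_vec (kron_vec_pow u n) = dim_vec u ^ n"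
  by (induction n) (simp_all add: kron_vec_def)

lemma kron_mat_pow_ket_bra: "kron_mat_pow (ket_bra u) n = ket_bra (kron_vec_pow u n)"
proof (induction n)
  case 0
  show ?case by (rule eq_matI) (auto simp: ket_bra_def)
next
  case (Suc n)
  show ?case
    unfolding kron_mat_pow.simps kron_vec_pow.simps Suc
  proof (rule eq_matI)
    fix i j
    assume "i < dim_row (ket_bra (kron_vec u (kron_vec_pow u n)))"
      and "j < dim_col (ket_bra (kron_vec u (kron_vec_pow u n)))"
    then have i: "i < dim_vec u * dim_vec u ^ n" and j: "j < dim_vec u * dim_vec u ^ n"
      by (auto simp: ket_bra_def kron_vec_def)
    then have "0 < dim_vec u ^ n" by (cases "dim_vec u ^ n") auto
    then show "kron_mat (ket_bra u) (ket_bra (kron_vec_pow u n)) $$ (i, j) =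
        ket_bra (kron_vec u (kron_vec_pow u n)) $$ (i, j)"
      using i j div_less_of_less_mult[OF i] div_less_of_less_mult[OF j]
      by (simp add: kron_mat_def ket_bra_def kron_vec_def)
  qed (auto simp: kron_mat_def ket_bra_def kron_vec_def)
qed

text \<open>The Hamiltonian enters what follows only through this data: \<open>v l\<close> stands
  for the component of the initial state in the eigenspace of energy \<open>l\<close>.\<close>

locale energy_decomposition =
  fixes d :: nat and \<Lambda> :: "real set" and v :: "real \<Rightarrow> nat \<Rightarrow> complex"
  assumes finite_spectrum: "finite \<Lambda>"
    and orthogonal: "\<And>l m. l \<in> \<Lambda> \<Longrightarrow> m \<in> \<Lambda> \<Longrightarrow> l \<noteq> m \<Longrightarrow> (\<Sum>i<d. cnj (v l i) * v m i) = 0"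
begin

definition weight :: "real \<Rightarrow> real" where
  "weight l = (\<Sum>i<d. (norm (v l i))\<^sup>2)"

primrec energies :: "nat \<Rightarrow> real set" where
  "energies 0 = {0}"
| "energies (Suc n) = (\<lambda>(l, E). E + l) ` (\<Lambda> \<times> energies n)"

text \<open>\<open>component n E\<close> is the part of energy \<open>E\<close> of the \<open>n\<close>-th tensor power of the vector
  \<open>\<Sum>l\<in>\<Lambda>. v l\<close>, and \<open>energy_prob n E\<close> its squared norm.\<close>

primrec component :: "nat \<Rightarrow> real \<Rightarrow> nat \<Rightarrow> complex" where
  "component 0 E a = (if E = 0 then 1 else 0)"
| "component (Suc n) E a = (\<Sum>l\<in>\<Lambda>. v l (a div d ^ n) * component n (E - l) (a mod d ^ n))"

primrec energy_prob :: "nat \<Rightarrow> real \<Rightarrow> real" where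
  "energy_prob 0 E = (if E = 0 then 1 else 0)"
| "energy_prob (Suc n) E = (\<Sum>l\<in>\<Lambda>. weight l * energy_prob n (E - l))"

lemma finite_energies: "finite (energies n)"
  by (induction n) (auto simp: finite_spectrum)

lemma energies_shift: "l \<in> \<Lambda> \<Longrightarrow> (\<lambda>E. E + l) ` energies n \<subseteq> energies (Suc n)"
  by force

lemma energies_bound:
  assumes "\<And>l. l \<in> \<Lambda> \<Longrightarrow> \<bar>l\<bar> \<le> R" "E \<in> energies n"
  shows "\<bar>E\<bar> \<le> R * real n"
  using assms(2)
proof (induction n arbitrary: E)
  case (Suc n)
  then obtain l E' where E: "E = E' + l" "l \<in> \<Lambda>" "E' \<in> energies n" by auto
  then show ?case using Suc.IH[of E'] assms(1)[of l] by (simp add: algebra_simps)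
qed simp

lemma component_outside: "E \<notin> energies n \<Longrightarrow> component n E a = 0"
proof (induction n arbitrary: E a)
  case (Suc n)
  have "E - l \<notin> energies n" if "l \<in> \<Lambda>" for l
    using Suc.prems energies_shift[OF that, of n] by (metis diff_add_cancel imageI subsetD)
  then show ?case using Suc.IH by simp
qed simp

lemma energy_prob_outside: "E \<notin> energies n \<Longrightarrow> energy_prob n E = 0"
proof (induction n arbitrary: E)
  case (Suc n)
  have "E - l \<notin> energies n" if "l \<in> \<Lambda>" for l
    using Suc.prems energies_shift[OF that, of n] by (metis diff_add_cancel imageI subsetD)
  then show ?case using Suc.IH by simp
qed simp

lemma weight_nonneg: "0 \<le> weight l"
  by (simp add: weight_def sum_nonneg)

lemma energy_prob_nonneg: "0 \<le> energy_prob n E"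
  by (induction n arbitrary: E) (auto intro!: sum_nonneg mult_nonneg_nonneg simp: weight_nonneg)

text \<open>Inner products factor over the div/mod index. Orthogonality of the \<open>v l\<close>
  leaves only \<open>l = m\<close>, where the induction hypothesis compares \<open>E - l\<close>
  with \<open>E' - l\<close>; what remains is the recursion of \<open>energy_prob\<close>.\<close>

lemma component_inner:
  "(\<Sum>a<d ^ n. cnj (component n E a) * component n E' a) =
    (if E = E' then of_real (energy_prob n E) else 0)"
proof (induction n arbitrary: E E')
  case (Suc n)
  have v_inner: "(\<Sum>i<d. cnj (v l i) * v m i) = (if l = m then of_real (weight l) else 0)"
    if "l \<in> \<Lambda>" "m \<in> \<Lambda>" for l m
  proof (cases "l = m")
    case True
    have "(\<Sum>i<d. cnj (v l i) * v l i) = of_real (weight l)"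
      unfolding weight_def by (simp only: of_real_sum complex_norm_square mult.commute)
    then show ?thesis using True by simp
  qed (use orthogonal that in simp)
  have "(\<Sum>a<d ^ Suc n. cnj (component (Suc n) E a) * component (Suc n) E' a) =
      (\<Sum>r<d * d ^ n. (\<lambda>i a. \<Sum>l\<in>\<Lambda>. \<Sum>m\<in>\<Lambda>. (cnj (v l i) * v m i) *
        (cnj (component n (E - l) a) * component n (E' - m) a)) (r div d ^ n) (r mod d ^ n))"
    unfolding power_Suc component.simps cnj_sum sum_product complex_cnj_mult
    by (intro sum.cong refl) (simp only: mult_ac)
  also have "\<dots> = (\<Sum>i<d. \<Sum>a<d ^ n. \<Sum>l\<in>\<Lambda>. \<Sum>m\<in>\<Lambda>. (cnj (v l i) * v m i) *
        (cnj (component n (E - l) a) * component n (E' - m) a))"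
    by (rule sum_div_mod)
  also have "\<dots> = (\<Sum>i<d. \<Sum>l\<in>\<Lambda>. \<Sum>m\<in>\<Lambda>. (cnj (v l i) * v m i) *
        (\<Sum>a<d ^ n. cnj (component n (E - l) a) * component n (E' - m) a))"
    unfolding sum_distrib_left
    by (rule sum.cong[OF refl], subst sum.swap, rule sum.cong[OF refl], rule sum.swap)
  also have "\<dots> = (\<Sum>l\<in>\<Lambda>. \<Sum>m\<in>\<Lambda>. (\<Sum>i<d. cnj (v l i) * v m i) *
        (\<Sum>a<d ^ n. cnj (component n (E - l) a) * component n (E' - m) a))"
    unfolding sum_distrib_right
    by (subst sum.swap, rule sum.cong[OF refl], rule sum.swap)
  also have "\<dots> = (\<Sum>l\<in>\<Lambda>. \<Sum>m\<in>\<Lambda>. if l = m then of_real (weight l) *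
        (if E - l = E' - m then of_real (energy_prob n (E - l)) else 0) else 0)"
    by (intro sum.cong refl) (simp add: v_inner Suc)
  also have "\<dots> = (\<Sum>l\<in>\<Lambda>. of_real (weight l) *
        (if E = E' then of_real (energy_prob n (E - l)) else 0))"
    using finite_spectrum by simp
  also have "\<dots> = (if E = E' then of_real (energy_prob (Suc n) E) else 0)" by simp
  finally show ?case .
qed simp

text \<open>The distribution \<open>energy_prob n\<close> is the \<open>n\<close>-fold convolution
  of \<open>weight\<close>, as for a sum of independent variables, so its Fourier transform is an
  \<open>n\<close>-th power.\<close>

lemma energy_characteristic:
  "(\<Sum>E\<in>energies n. of_real (energy_prob n E) * cis (E * t)) = (\<Sum>l\<in>\<Lambda>. of_real (weight l) * cis (l * t)) ^ n"
proof (induction n)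
  case (Suc n)
  have "(\<Sum>E\<in>energies (Suc n). of_real (energy_prob (Suc n) E) * cis (E * t)) =
      (\<Sum>l\<in>\<Lambda>. of_real (weight l) * (\<Sum>E\<in>energies (Suc n). cis (E * t) * of_real (energy_prob n (E - l))))"
    by (simp add: sum_distrib_left sum_distrib_right algebra_simps) (rule sum.swap)
  also have "\<dots> = (\<Sum>l\<in>\<Lambda>. of_real (weight l) * (\<Sum>E\<in>energies n. cis ((E + l) * t) * of_real (energy_prob n E)))"
    by (intro sum.cong refl arg_cong2[of _ _ _ _ "(*)"] sum_shift_support finite_energies energies_shift)
      (simp_all add: energy_prob_outside)
  also have "\<dots> = (\<Sum>l\<in>\<Lambda>. of_real (weight l) * cis (l * t) *
      (\<Sum>E\<in>energies n. of_real (energy_prob n E) * cis (E * t)))"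
    by (simp add: sum_distrib_left cis_mult[symmetric] distrib_right algebra_simps)
  also have "\<dots> = (\<Sum>l\<in>\<Lambda>. of_real (weight l) * cis (l * t)) ^ Suc n"
    unfolding Suc by (simp flip: sum_distrib_right)
  finally show ?case .
qed simp

text \<open>Phases multiply when energies add, so the product of the two expansions regroups by
  total energy, and this regrouping is the recursion of \<open>component\<close>.\<close>

lemma kron_vec_pow_component:
  assumes dim: "dim_vec u = d" and u: "\<And>i. i < d \<Longrightarrow> u $ i = (\<Sum>l\<in>\<Lambda>. cis (- l * t) * v l i)"
    and a: "a < d ^ n"
  shows "kron_vec_pow u n $ a = (\<Sum>E\<in>energies n. cis (- E * t) * component n E a)"
  using a
proof (induction n arbitrary: a)
  case (Suc n)
  have a: "a < d * d ^ n" using Suc.prems by simp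
  then have pos: "0 < d ^ n" by (cases "d ^ n") auto
  have "kron_vec_pow u (Suc n) $ a = u $ (a div d ^ n) * kron_vec_pow u n $ (a mod d ^ n)"
    using a by (simp add: kron_vec_def dim)
  also have "\<dots> = (\<Sum>l\<in>\<Lambda>. cis (- l * t) * v l (a div d ^ n)) *
      (\<Sum>E\<in>energies n. cis (- E * t) * component n E (a mod d ^ n))"
    using u[OF div_less_of_less_mult[OF a]] Suc.IH[of "a mod d ^ n"] pos by simp
  also have "\<dots> = (\<Sum>l\<in>\<Lambda>. v l (a div d ^ n) *
      (\<Sum>E\<in>energies n. cis (- (E + l) * t) * component n E (a mod d ^ n)))"
    unfolding sum_product
  proof (rule sum.cong[OF refl], subst sum_distrib_left, rule sum.cong[OF refl])
    fix l E
    have "cis (- (E + l) * t) = cis (- l * t) * cis (- E * t)"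
      by (simp add: cis_mult algebra_simps)
    then show "cis (- l * t) * v l (a div d ^ n) * (cis (- E * t) * component n E (a mod d ^ n)) =
        v l (a div d ^ n) * (cis (- (E + l) * t) * component n E (a mod d ^ n))"
      by (simp only: mult_ac)
  qed
  also have "\<dots> = (\<Sum>l\<in>\<Lambda>. v l (a div d ^ n) *
      (\<Sum>E\<in>energies (Suc n). cis (- E * t) * component n (E - l) (a mod d ^ n)))"
    by (intro sum.cong refl arg_cong2[of _ _ _ _ "(*)"] sum_shift_support[symmetric]
        finite_energies energies_shift) (simp_all add: component_outside)
  also have "\<dots> = (\<Sum>E\<in>energies (Suc n). cis (- E * t) * component (Suc n) E a)"
    by (simp add: sum_distrib_left algebra_simps) (rule sum.swap)
  finally show ?case .
qed simp

text \<open>The left side will be the squared norm of a vector \<open>B w\<close>. The translated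
  spectrum lies within \<open>R * real N\<close> of \<open>w\<close>, and its points outside
  \<open>energies M\<close> carry no probability.\<close>

lemma energy_prob_window:
  assumes "\<And>l. l \<in> \<Lambda> \<Longrightarrow> \<bar>l\<bar> \<le> R"
  shows "(\<Sum>E\<in>energies N. energy_prob M (E + w)) \<le>
    (\<Sum>F | F \<in> energies M \<and> \<bar>F - w\<bar> \<le> R * real N. energy_prob M F)"
proof -
  have "(\<Sum>E\<in>energies N. energy_prob M (E + w)) = (\<Sum>F\<in>(\<lambda>E. E + w) ` energies N. energy_prob M F)"
    by (subst sum.reindex) (auto simp: inj_on_def)
  also have "\<dots> = (\<Sum>F\<in>(\<lambda>E. E + w) ` energies N \<inter> energies M. energy_prob M F)"
    by (rule sum.mono_neutral_right) (auto simp: finite_energies energy_prob_outside)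
  also have "\<dots> \<le> (\<Sum>F | F \<in> energies M \<and> \<bar>F - w\<bar> \<le> R * real N. energy_prob M F)"
    by (rule sum_mono2) (use energies_bound[OF assms] finite_energies in \<open>auto simp: energy_prob_nonneg\<close>)
  finally show ?thesis .
qed

end


section \<open>Spectral decomposition of the evolution\<close>

definition eigvec_at :: "nat \<Rightarrow> complex mat \<Rightarrow> complex \<Rightarrow> (nat \<Rightarrow> complex) \<Rightarrow> bool" where
  "eigvec_at d H l f \<longleftrightarrow> (\<forall>i<d. (\<Sum>j<d. H $$ (i, j) * f j) = l * f i)"

definition eigsum :: "nat \<Rightarrow> complex mat \<Rightarrow> (nat \<Rightarrow> complex) \<Rightarrow> bool" where
  "eigsum d H x \<longleftrightarrow> (\<exists>\<Lambda> u. finite \<Lambda> \<and> (\<forall>l\<in>\<Lambda>. eigvec_at d H l (u l)) \<and>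
     (\<forall>i<d. x i = (\<Sum>l\<in>\<Lambda>. u l i)))"

lemma hermitian_entries:
  assumes "H \<in> carrier_mat d d" "mat_adjoint H = H" "i < d" "j < d"
  shows "cnj (H $$ (i, j)) = H $$ (j, i)"
proof -
  have "H $$ (j, i) = mat_adjoint H $$ (j, i)" using assms by simp
  also have "\<dots> = cnj (H $$ (i, j))"
    using assms(1,3,4) by (simp add: mat_adjoint_def mat_of_rows_def)
  finally show ?thesis by simp
qed

lemma hermitian_adjoint:
  assumes H: "H \<in> carrier_mat d d" "mat_adjoint H = H"
  shows "(\<Sum>i<d. cnj (f i) * (\<Sum>j<d. H $$ (i, j) * g j)) =
    (\<Sum>i<d. cnj (\<Sum>j<d. H $$ (i, j) * f j) * g i)"
proof -
  have "(\<Sum>i<d. cnj (f i) * (\<Sum>j<d. H $$ (i, j) * g j)) =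
      (\<Sum>i<d. \<Sum>j<d. cnj (f i) * (H $$ (i, j) * g j))"
    by (simp add: sum_distrib_left)
  also have "\<dots> = (\<Sum>j<d. \<Sum>i<d. cnj (f i) * (H $$ (i, j) * g j))" by (rule sum.swap)
  also have "\<dots> = (\<Sum>j<d. \<Sum>i<d. cnj (H $$ (j, i) * f i) * g j)"
    by (intro sum.cong refl) (simp add: hermitian_entries[OF H] mult.commute)
  also have "\<dots> = (\<Sum>i<d. cnj (\<Sum>j<d. H $$ (i, j) * f j) * g i)"
    by (simp add: sum_distrib_right)
  finally show ?thesis .
qed

lemma sum_cnj_self_eq_0_iff:
  "finite A \<Longrightarrow> (\<Sum>i\<in>A. cnj (f i) * f i) = 0 \<longleftrightarrow> (\<forall>i\<in>A. f i = (0::complex))"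
proof -
  assume A: "finite A"
  have "(\<Sum>i\<in>A. cnj (f i) * f i) = complex_of_real (\<Sum>i\<in>A. (norm (f i))\<^sup>2)"
    by (simp only: of_real_sum complex_norm_square mult.commute)
  then have "(\<Sum>i\<in>A. cnj (f i) * f i) = 0 \<longleftrightarrow> (\<Sum>i\<in>A. (norm (f i))\<^sup>2) = 0"
    by (simp only: of_real_eq_0_iff)
  then show ?thesis using A by (simp add: sum_nonneg_eq_0_iff)
qed

text \<open>With \<open>cnj a \<noteq> b\<close> in place of \<open>a \<noteq> b\<close> the lemma
  also covers \<open>f = g\<close> at a nonreal eigenvalue, which forces \<open>f\<close> to
  vanish.\<close>

lemma eigvec_at_orthogonal:
  assumes H: "H \<in> carrier_mat d d" "mat_adjoint H = H"
    and f: "eigvec_at d H a f" and g: "eigvec_at d H b g" and ne: "cnj a \<noteq> b"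
  shows "(\<Sum>i<d. cnj (f i) * g i) = 0"
proof -
  have "b * (\<Sum>i<d. cnj (f i) * g i) = (\<Sum>i<d. cnj (f i) * (\<Sum>j<d. H $$ (i, j) * g j))"
    using g by (simp add: eigvec_at_def sum_distrib_left algebra_simps)
  also have "\<dots> = (\<Sum>i<d. cnj (\<Sum>j<d. H $$ (i, j) * f j) * g i)"
    by (rule hermitian_adjoint[OF H])
  also have "\<dots> = cnj a * (\<Sum>i<d. cnj (f i) * g i)"
    using f by (simp add: eigvec_at_def sum_distrib_left algebra_simps del: cnj_sum)
  finally show ?thesis using ne by simp
qed

lemma eigvec_at_nonreal:
  assumes "H \<in> carrier_mat d d" "mat_adjoint H = H" "eigvec_at d H a f" "cnj a \<noteq> a" "i < d"
  shows "f i = 0"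
  using eigvec_at_orthogonal[OF assms(1-3,3,4)] sum_cnj_self_eq_0_iff[of "{..<d}" f] assms(5) by simp

lemma eigsum_lincomb:
  assumes J: "finite J" and f: "\<And>j. j \<in> J \<Longrightarrow> eigsum d H (f j)"
  shows "eigsum d H (\<lambda>i. \<Sum>j\<in>J. c j * f j i)"
proof -
  obtain \<Lambda> u where fin: "\<And>j. j \<in> J \<Longrightarrow> finite (\<Lambda> j)"
    and ev: "\<And>j l. j \<in> J \<Longrightarrow> l \<in> \<Lambda> j \<Longrightarrow> eigvec_at d H l (u j l)"
    and f: "\<And>j i. j \<in> J \<Longrightarrow> i < d \<Longrightarrow> f j i = (\<Sum>l\<in>\<Lambda> j. u j l i)"
    using f unfolding eigsum_def by metis
  \<comment> \<open>Contributions of different \<open>j\<close> to the same eigenvalue are merged,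
    with 0 where \<open>l\<close> does not occur for \<open>j\<close>.\<close>
  define v where "v l i = (\<Sum>j\<in>J. c j * (if l \<in> \<Lambda> j then u j l i else 0))" for l i
  have "eigvec_at d H l (v l)" for l
    unfolding eigvec_at_def
  proof (intro allI impI)
    fix i assume i: "i < d"
    have "(\<Sum>k<d. H $$ (i, k) * v l k) =
        (\<Sum>j\<in>J. c j * (\<Sum>k<d. H $$ (i, k) * (if l \<in> \<Lambda> j then u j l k else 0)))"
      unfolding v_def sum_distrib_left by (subst sum.swap) (simp add: algebra_simps)
    also have "\<dots> = (\<Sum>j\<in>J. c j * (l * (if l \<in> \<Lambda> j then u j l i else 0)))"
      using ev i by (intro sum.cong refl) (auto simp: eigvec_at_def)
    finally show "(\<Sum>k<d. H $$ (i, k) * v l k) = l * v l i"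
      by (simp add: v_def sum_distrib_left algebra_simps)
  qed
  moreover have "(\<Sum>j\<in>J. c j * f j i) = (\<Sum>l\<in>(\<Union>j\<in>J. \<Lambda> j). v l i)" if i: "i < d" for i
  proof -
    have "f j i = (\<Sum>l\<in>(\<Union>j\<in>J. \<Lambda> j). if l \<in> \<Lambda> j then u j l i else 0)" if "j \<in> J" for j
    proof -
      have "(\<Union>j\<in>J. \<Lambda> j) \<inter> \<Lambda> j = \<Lambda> j" using that by blast
      then show ?thesis using f[OF that i] fin J by (simp flip: sum.inter_restrict)
    qed
    then show ?thesis
      unfolding v_def by (subst sum.swap) (simp add: sum_distrib_left)
  qed
  moreover have "finite (\<Union>j\<in>J. \<Lambda> j)" using J fin by blast
  ultimately show ?thesis unfolding eigsum_def by blast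
qed

text \<open>A generalised eigenvector of a Hermitian matrix is an eigenvector, so \<open>H - b\<close> can be
  inverted on sums of eigenvectors.\<close>

lemma eigsum_if_shifted:
  assumes H: "H \<in> carrier_mat d d" "mat_adjoint H = H"
    and y: "eigsum d H (\<lambda>i. (\<Sum>j<d. H $$ (i, j) * x j) - b * x i)"
  shows "eigsum d H x"
proof -
  obtain \<Lambda> u where fin: "finite \<Lambda>" and ev: "\<And>l. l \<in> \<Lambda> \<Longrightarrow> eigvec_at d H l (u l)"
    and y: "\<And>i. i < d \<Longrightarrow> (\<Sum>j<d. H $$ (i, j) * x j) - b * x i = (\<Sum>l\<in>\<Lambda>. u l i)"
    using y unfolding eigsum_def by blast
  define z where "z i = (if b \<in> \<Lambda> then u b i else 0)" for i
  \<comment> \<open>Subtracting a preimage under \<open>H - b\<close> of all components with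
    \<open>l \<noteq> b\<close> leaves \<open>(H - b) w = z\<close>, where \<open>z\<close> lies in
    the kernel of \<open>H - b\<close>.\<close>
  define w where "w i = x i - (\<Sum>l\<in>\<Lambda> - {b}. u l i / (l - b))" for i
  have z: "eigvec_at d H b z" using ev[of b] by (auto simp: eigvec_at_def z_def)
  have Hw: "(\<Sum>j<d. H $$ (i, j) * w j) = b * w i + z i" if i: "i < d" for i
  proof -
    have "(\<Sum>j<d. H $$ (i, j) * (\<Sum>l\<in>\<Lambda> - {b}. u l j / (l - b))) =
        (\<Sum>l\<in>\<Lambda> - {b}. (\<Sum>j<d. H $$ (i, j) * u l j) / (l - b))"
      unfolding sum_distrib_left by (subst sum.swap) (simp add: sum_divide_distrib)
    also have "\<dots> = (\<Sum>l\<in>\<Lambda> - {b}. u l i + b * (u l i / (l - b)))"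
      using ev i by (intro sum.cong refl) (auto simp: eigvec_at_def field_simps)
    also have "\<dots> = (\<Sum>l\<in>\<Lambda> - {b}. u l i) + b * (\<Sum>l\<in>\<Lambda> - {b}. u l i / (l - b))"
      by (simp add: sum.distrib sum_distrib_left)
    finally have "(\<Sum>j<d. H $$ (i, j) * w j) = b * w i + ((\<Sum>l\<in>\<Lambda>. u l i) - (\<Sum>l\<in>\<Lambda> - {b}. u l i))"
      using y[OF i] by (simp add: w_def right_diff_distrib sum_subtractf algebra_simps)
    also have "(\<Sum>l\<in>\<Lambda>. u l i) - (\<Sum>l\<in>\<Lambda> - {b}. u l i) = z i"
      using fin by (simp add: z_def sum_diff1)
    finally show ?thesis .
  qed
  \<comment> \<open>For real \<open>b\<close>, moving \<open>H - b\<close> to the other side gives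
    \<open>\<langle>z|z\<rangle> = \<langle>z|(H - b) w\<rangle> = \<langle>(H - b) z|w\<rangle> =
    0\<close>.\<close>
  have z0: "z i = 0" if i: "i < d" for i
  proof (cases "cnj b = b")
    case True
    have "(\<Sum>i<d. cnj (z i) * (\<Sum>j<d. H $$ (i, j) * w j)) =
        (\<Sum>i<d. cnj (\<Sum>j<d. H $$ (i, j) * z j) * w i)"
      by (rule hermitian_adjoint[OF H])
    also have "\<dots> = (\<Sum>i<d. cnj (z i) * (b * w i))"
      using z True by (simp add: eigvec_at_def algebra_simps del: cnj_sum)
    finally have "(\<Sum>i<d. cnj (z i) * z i) = 0"
      by (simp add: Hw distrib_left sum.distrib)
    then show ?thesis using i sum_cnj_self_eq_0_iff[of "{..<d}" z] by simp
  next
    case False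
    with eigvec_at_nonreal[OF H z] i show ?thesis by blast
  qed
  define v where "v l i = (if l = b then w i else u l i / (l - b))" for l i
  have "eigvec_at d H l (v l)" if "l \<in> insert b \<Lambda>" for l
  proof (cases "l = b")
    case True
    then show ?thesis using Hw z0 by (simp add: eigvec_at_def v_def)
  next
    case False
    then show ?thesis using that ev[of l]
      by (simp add: eigvec_at_def v_def flip: sum_divide_distrib)
  qed
  moreover have "x i = (\<Sum>l\<in>insert b \<Lambda>. v l i)" for i
    using fin by (simp add: sum.insert_remove v_def w_def)
  ultimately show ?thesis unfolding eigsum_def using fin by blast
qed

text \<open>Schur triangularisation gives \<open>H * P = P * B\<close>, so
  \<open>H - B $$ (k, k)\<close> maps column \<open>k\<close> of \<open>P\<close> into the span of
  the earlier columns. Strong induction with \<open>eigsum_if_shifted\<close> handles the columns,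
  and they span because \<open>P\<close> is invertible.\<close>

lemma eigsum_all:
  assumes H: "H \<in> carrier_mat d d" "mat_adjoint H = H"
  shows "eigsum d H x"
proof -
  obtain es where "char_poly H = (\<Prod>a\<leftarrow>es. [:- a, 1:])"
    using char_poly_factorized[OF H(1)] by auto
  from schur_decomposition_exists[OF H(1) this] obtain B P Q where B: "B \<in> carrier_mat d d"
    and up: "upper_triangular B" and sim: "similar_mat_wit H B P Q"
    by (auto simp: similar_mat_def)
  note D = similar_mat_witD2[OF H(1) sim]
  have P: "P \<in> carrier_mat d d" and Q: "Q \<in> carrier_mat d d" and PQ: "P * Q = 1\<^sub>m d"
    using D by auto
  have "H * P = P * B * (Q * P)"
    using D B P Q by (simp add: assoc_mult_mat[of _ d d _ d _ d])
  then have HP: "H * P = P * B" using D B P by simp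
  have col: "eigsum d H (\<lambda>i. P $$ (i, k))" if "k < d" for k
    using that
  proof (induction k rule: less_induct)
    case (less k)
    have "(\<Sum>j<d. H $$ (i, j) * P $$ (j, k)) - B $$ (k, k) * P $$ (i, k) =
        (\<Sum>j<k. B $$ (j, k) * P $$ (i, j))" if i: "i < d" for i
    proof -
      have "(\<Sum>j<d. H $$ (i, j) * P $$ (j, k)) = (H * P) $$ (i, k)"
        using H P i less.prems by (simp add: scalar_prod_def atLeast0LessThan)
      also have "\<dots> = (\<Sum>j<d. B $$ (j, k) * P $$ (i, j))"
        unfolding HP using B P i less.prems by (simp add: scalar_prod_def atLeast0LessThan mult.commute)
      also have "\<dots> = (\<Sum>j<Suc k. B $$ (j, k) * P $$ (i, j))"
        by (rule sum.mono_neutral_right) (use less.prems up B in \<open>auto simp: upper_triangular_def\<close>)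
      finally show ?thesis by simp
    qed
    moreover have "eigsum d H (\<lambda>i. \<Sum>j<k. B $$ (j, k) * P $$ (i, j))"
      by (rule eigsum_lincomb) (use less in auto)
    ultimately have "eigsum d H (\<lambda>i. (\<Sum>j<d. H $$ (i, j) * P $$ (j, k)) - B $$ (k, k) * P $$ (i, k))"
      unfolding eigsum_def by simp
    then show ?case by (rule eigsum_if_shifted[OF H])
  qed
  define y where "y = Q *\<^sub>v vec d x"
  have "x i = (\<Sum>k<d. y $ k * P $$ (i, k))" if i: "i < d" for i
  proof -
    have "P *\<^sub>v y = vec d x"
      unfolding y_def using P Q PQ by (simp flip: assoc_mult_mat_vec[of P d d Q d])
    then have "x i = (P *\<^sub>v y) $ i" using i by simp
    also have "\<dots> = (\<Sum>k<d. y $ k * P $$ (i, k))"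
      using P Q i by (simp add: y_def scalar_prod_def atLeast0LessThan mult.commute)
    finally show ?thesis .
  qed
  moreover have "eigsum d H (\<lambda>i. \<Sum>k<d. y $ k * P $$ (i, k))"
    by (rule eigsum_lincomb) (use col in auto)
  ultimately show ?thesis unfolding eigsum_def by simp
qed

section \<open>The matrix exponential on energy components\<close>

lemma pow_mat_eigvec:
  assumes H: "H \<in> carrier_mat d d" and f: "eigvec_at d H l f" and i: "i < d"
  shows "(\<Sum>j<d. ((a \<cdot>\<^sub>m H) ^\<^sub>m k) $$ (i, j) * f j) = (a * l) ^ k * f i"
proof (induction k)
  case 0
  have "(\<Sum>j<d. (1\<^sub>m d) $$ (i, j) * f j) = (\<Sum>j<d. if i = j then f j else 0)"
    using i by (intro sum.cong) auto
  then show ?case using H i by simp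
next
  case (Suc k)
  let ?A = "a \<cdot>\<^sub>m H"
  have A: "?A \<in> carrier_mat d d" and Ak: "?A ^\<^sub>m k \<in> carrier_mat d d" using H by auto
  have "(\<Sum>j<d. (?A ^\<^sub>m Suc k) $$ (i, j) * f j) =
      (\<Sum>j<d. \<Sum>m<d. (?A ^\<^sub>m k) $$ (i, m) * (a * (H $$ (m, j) * f j)))"
    using H A Ak i by (intro sum.cong refl)
      (simp add: scalar_prod_def atLeast0LessThan sum_distrib_right mult.assoc)
  also have "\<dots> = (\<Sum>m<d. (?A ^\<^sub>m k) $$ (i, m) * (a * (\<Sum>j<d. H $$ (m, j) * f j)))"
    by (subst sum.swap) (simp add: sum_distrib_left)
  also have "\<dots> = (\<Sum>m<d. (?A ^\<^sub>m k) $$ (i, m) * (a * (l * f m)))"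
    using f by (simp add: eigvec_at_def)
  also have "\<dots> = a * l * (\<Sum>m<d. (?A ^\<^sub>m k) $$ (i, m) * f m)"
    by (simp add: sum_distrib_left algebra_simps)
  finally show ?case using Suc by simp
qed

text \<open>A single family \<open>u\<close> has to serve all \<open>a\<close>. Decomposing the unit
  vectors, independently of \<open>a\<close>, yields the entries of all powers and hence of the
  exponential series; the expansion of \<open>\<psi>\<close> follows by linearity.\<close>

lemma mat_exp_mult_eigsum:
  assumes H: "H \<in> carrier_mat d d" "mat_adjoint H = H" and \<psi>: "\<psi> \<in> carrier_vec d"
  shows "\<exists>\<Lambda> u. finite \<Lambda> \<and> (\<forall>l\<in>\<Lambda>. eigvec_at d H l (u l)) \<and>
    (\<forall>a. \<forall>i<d. (mat_exp (a \<cdot>\<^sub>m H) *\<^sub>v \<psi>) $ i = (\<Sum>l\<in>\<Lambda>. exp (a * l) * u l i)) \<and>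
    (\<forall>i<d. \<psi> $ i = (\<Sum>l\<in>\<Lambda>. u l i))"
proof -
  have "\<forall>j. \<exists>\<Lambda> u. finite \<Lambda> \<and> (\<forall>l\<in>\<Lambda>. eigvec_at d H l (u l)) \<and>
      (\<forall>i<d. (if i = j then 1 else 0) = (\<Sum>l\<in>\<Lambda>. u l i))"
    using eigsum_all[OF H, of "\<lambda>i. if i = _ then 1 else 0"] unfolding eigsum_def by (rule allI)
  then obtain \<Lambda> u where fin: "\<And>j. finite (\<Lambda> j)"
    and ev: "\<And>j l. l \<in> \<Lambda> j \<Longrightarrow> eigvec_at d H l (u j l)"
    and unit: "\<And>j i. i < d \<Longrightarrow> (if i = j then 1 else 0) = (\<Sum>l\<in>\<Lambda> j. u j l i)"
    by metis
  define L where "L = (\<Union>j<d. \<Lambda> j)"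
  define U where "U j l i = (if l \<in> \<Lambda> j then u j l i else 0)" for j l i
  have finL: "finite L" using fin by (auto simp: L_def)
  have evU: "eigvec_at d H l (U j l)" for j l
    using ev[of l j] by (auto simp: eigvec_at_def U_def)
  have unitU: "(\<Sum>l\<in>L. U j l i) = (if i = j then 1 else 0)" if "i < d" "j < d" for i j
  proof -
    have "L \<inter> \<Lambda> j = \<Lambda> j" using that by (auto simp: L_def)
    then show ?thesis using unit[OF that(1), of j] finL by (simp add: U_def flip: sum.inter_restrict)
  qed
  define v where "v l i = (\<Sum>j<d. \<psi> $ j * U j l i)" for l i
  have "eigvec_at d H l (v l)" for l
    unfolding eigvec_at_def
  proof (intro allI impI)
    fix i assume i: "i < d"
    have "(\<Sum>k<d. H $$ (i, k) * v l k) = (\<Sum>j<d. \<psi> $ j * (\<Sum>k<d. H $$ (i, k) * U j l k))"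
      unfolding v_def sum_distrib_left by (subst sum.swap) (simp add: algebra_simps)
    also have "\<dots> = l * v l i"
      using evU i by (simp add: eigvec_at_def v_def sum_distrib_left algebra_simps)
    finally show "(\<Sum>k<d. H $$ (i, k) * v l k) = l * v l i" .
  qed
  moreover have "(mat_exp (a \<cdot>\<^sub>m H) *\<^sub>v \<psi>) $ i = (\<Sum>l\<in>L. exp (a * l) * v l i)"
    if i: "i < d" for a i
  proof -
    let ?A = "a \<cdot>\<^sub>m H"
    have entry: "mat_exp ?A $$ (i, j) = (\<Sum>l\<in>L. exp (a * l) * U j l i)" if j: "j < d" for j
    proof -
      \<comment> \<open>Column \<open>j\<close> of the power is its action on the
        \<open>j\<close>-th unit vector, where each eigencomponent is multiplied by
        \<open>(a * l) ^ k\<close>.\<close>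
      have pw: "(?A ^\<^sub>m k) $$ (i, j) = (\<Sum>l\<in>L. (a * l) ^ k * U j l i)" for k
      proof -
        have "(?A ^\<^sub>m k) $$ (i, j) = (\<Sum>m<d. (?A ^\<^sub>m k) $$ (i, m) * (\<Sum>l\<in>L. U j l m))"
          using j by (simp add: unitU if_distrib cong: if_cong)
        also have "\<dots> = (\<Sum>l\<in>L. \<Sum>m<d. (?A ^\<^sub>m k) $$ (i, m) * U j l m)"
          unfolding sum_distrib_left by (rule sum.swap)
        finally show ?thesis using pow_mat_eigvec[OF H(1) evU i] by simp
      qed
      have "(\<lambda>k. \<Sum>l\<in>L. ((a * l) ^ k /\<^sub>R fact k) * U j l i) sums (\<Sum>l\<in>L. exp (a * l) * U j l i)"
        by (intro sums_sum sums_mult2 exp_converges)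
      moreover have "(\<Sum>l\<in>L. ((a * l) ^ k /\<^sub>R fact k) * U j l i) = (?A ^\<^sub>m k) $$ (i, j) / fact k" for k
        unfolding pw sum_divide_distrib
        by (intro sum.cong refl) (simp add: scaleR_conv_of_real field_simps)
      ultimately have "(\<lambda>k. (?A ^\<^sub>m k) $$ (i, j) / fact k) sums (\<Sum>l\<in>L. exp (a * l) * U j l i)"
        by simp
      then show ?thesis using H i j by (simp add: mat_exp_def sums_iff)
    qed
    have "(mat_exp ?A *\<^sub>v \<psi>) $ i = (\<Sum>j<d. mat_exp ?A $$ (i, j) * \<psi> $ j)"
      using H \<psi> i by (simp add: mat_exp_def scalar_prod_def atLeast0LessThan)
    also have "\<dots> = (\<Sum>j<d. \<Sum>l\<in>L. exp (a * l) * (\<psi> $ j * U j l i))"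
      by (simp add: entry sum_distrib_left sum_distrib_right algebra_simps)
    also have "\<dots> = (\<Sum>l\<in>L. exp (a * l) * v l i)"
      by (subst sum.swap) (simp add: v_def sum_distrib_left)
    finally show ?thesis .
  qed
  moreover have "\<psi> $ i = (\<Sum>l\<in>L. v l i)" if "i < d" for i
  proof -
    have "(\<Sum>l\<in>L. v l i) = (\<Sum>j<d. \<psi> $ j * (\<Sum>l\<in>L. U j l i))"
      unfolding v_def sum_distrib_left by (rule sum.swap)
    also have "\<dots> = \<psi> $ i" using that by (simp add: unitU if_distrib cong: if_cong)
    finally show ?thesis by simp
  qed
  ultimately show ?thesis using finL by blast
qed

text \<open>Nonreal members of the eigenvalue set carry zero vectors, so real energies suffice. The
  weights sum to 1 by Pythagoras, so one is nonzero; if it were the only one, \<open>\<psi>\<close>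
  would be an eigenvector.\<close>

lemma evolved_energy_components:
  assumes H: "H \<in> carrier_mat d d" "mat_adjoint H = H"
    and \<psi>: "\<psi> \<in> carrier_vec d" "\<psi> \<bullet>c \<psi> = 1" and ne: "\<nexists>E. eigenvector H \<psi> E"
  obtains \<Lambda> v where "energy_decomposition d \<Lambda> v"
    and "\<forall>t. \<forall>i<d. evolved H \<psi> t $ i = (\<Sum>l\<in>\<Lambda>. cis (- l * t) * v l i)"
    and "(\<Sum>l\<in>\<Lambda>. \<Sum>i<d. (norm (v l i))\<^sup>2) = 1"
    and "\<exists>a\<in>\<Lambda>. \<exists>b\<in>\<Lambda>. a \<noteq> b \<and> 0 < (\<Sum>i<d. (norm (v a i))\<^sup>2) \<and> 0 < (\<Sum>i<d. (norm (v b i))\<^sup>2)"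
proof -
  obtain L u where fin: "finite L" and ev: "\<And>l. l \<in> L \<Longrightarrow> eigvec_at d H l (u l)"
    and evo: "\<And>a i. i < d \<Longrightarrow> (mat_exp (a \<cdot>\<^sub>m H) *\<^sub>v \<psi>) $ i = (\<Sum>l\<in>L. exp (a * l) * u l i)"
    and psi: "\<And>i. i < d \<Longrightarrow> \<psi> $ i = (\<Sum>l\<in>L. u l i)"
    using mat_exp_mult_eigsum[OF H \<psi>(1)] by blast
  define \<Lambda> where "\<Lambda> = {r::real. of_real r \<in> L}"
  define v where "v r = u (of_real r)" for r :: real
  have fin\<Lambda>: "finite \<Lambda>"
    unfolding \<Lambda>_def using finite_vimageI[OF fin, of complex_of_real] by (simp add: inj_of_real vimage_def)
  \<comment> \<open>The coefficient \<open>h\<close> is left general: 1 gives \<open>\<psi>\<close>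
    itself, the exponential gives the evolved state.\<close>
  have restrict: "(\<Sum>l\<in>L. h l * u l i) = (\<Sum>l\<in>\<Lambda>. h (of_real l) * v l i)" if i: "i < d" for h i
  proof -
    have "(\<Sum>l\<in>L. h l * u l i) = (\<Sum>l\<in>of_real ` \<Lambda>. h l * u l i)"
    proof (rule sum.mono_neutral_right[OF fin])
      show "\<forall>l\<in>L - of_real ` \<Lambda>. h l * u l i = 0"
      proof
        fix l assume l: "l \<in> L - of_real ` \<Lambda>"
        have "cnj l \<noteq> l"
        proof
          assume "cnj l = l"
          then have "l = of_real (Re l)" by (simp add: complex_eq_iff)
          moreover from this have "Re l \<in> \<Lambda>" using l by (simp add: \<Lambda>_def)
          ultimately show False using l by blast
        qed
        then show "h l * u l i = 0" using eigvec_at_nonreal[OF H ev _ i] l by simp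
      qed
    qed (auto simp: \<Lambda>_def)
    also have "\<dots> = (\<Sum>l\<in>\<Lambda>. h (of_real l) * v l i)"
      by (subst sum.reindex) (auto simp: inj_on_def v_def)
    finally show ?thesis .
  qed
  have evv: "eigvec_at d H (of_real l) (v l)" if "l \<in> \<Lambda>" for l
    using that ev by (simp add: \<Lambda>_def v_def)
  have orth: "(\<Sum>i<d. cnj (v l i) * v m i) = 0" if "l \<in> \<Lambda>" "m \<in> \<Lambda>" "l \<noteq> m" for l m
    using eigvec_at_orthogonal[OF H evv[OF that(1)] evv[OF that(2)]] that(3) by simp
  have psi_v: "\<psi> $ i = (\<Sum>l\<in>\<Lambda>. v l i)" if "i < d" for i
    using psi[OF that] restrict[OF that, of "\<lambda>_. 1"] by simp
  have norms: "(\<Sum>l\<in>\<Lambda>. \<Sum>i<d. (norm (v l i))\<^sup>2) = 1"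
  proof -
    have "1 = (\<Sum>i<d. \<psi> $ i * cnj (\<psi> $ i))"
      using \<psi> by (simp add: scalar_prod_def atLeast0LessThan)
    also have "\<dots> = (\<Sum>i<d. \<Sum>l\<in>\<Lambda>. \<Sum>m\<in>\<Lambda>. cnj (v m i) * v l i)"
      by (simp add: psi_v sum_product mult.commute)
    also have "\<dots> = (\<Sum>l\<in>\<Lambda>. \<Sum>m\<in>\<Lambda>. \<Sum>i<d. cnj (v m i) * v l i)"
      by (subst sum.swap, rule sum.cong[OF refl], rule sum.swap)
    also have "\<dots> = (\<Sum>l\<in>\<Lambda>. \<Sum>m\<in>\<Lambda>. if m = l then (\<Sum>i<d. cnj (v l i) * v l i) else 0)"
      using orth by (intro sum.cong refl) auto
    also have "\<dots> = (\<Sum>l\<in>\<Lambda>. \<Sum>i<d. cnj (v l i) * v l i)"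
      using fin\<Lambda> by simp
    also have "\<dots> = complex_of_real (\<Sum>l\<in>\<Lambda>. \<Sum>i<d. (norm (v l i))\<^sup>2)"
      by (simp only: of_real_sum complex_norm_square mult.commute)
    finally show ?thesis by (metis of_real_eq_1_iff)
  qed
  obtain a where a: "a \<in> \<Lambda>" "(\<Sum>i<d. (norm (v a i))\<^sup>2) \<noteq> 0"
  proof (rule ccontr)
    assume "\<not> thesis"
    then have "(\<Sum>l\<in>\<Lambda>. \<Sum>i<d. (norm (v l i))\<^sup>2) = 0" using that by (intro sum.neutral) blast
    then show False using norms by simp
  qed
  have "\<exists>b\<in>\<Lambda>. a \<noteq> b \<and> (\<Sum>i<d. (norm (v b i))\<^sup>2) \<noteq> 0"
  proof (rule ccontr)
    assume "\<not> ?thesis"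
    then have zero: "v b i = 0" if "b \<in> \<Lambda>" "b \<noteq> a" "i < d" for b i
      using that by (auto simp: sum_nonneg_eq_0_iff)
    have "\<psi> $ i = v a i" if i: "i < d" for i
    proof -
      have "(\<Sum>l\<in>\<Lambda>. v l i) = (\<Sum>l\<in>{a}. v l i)"
        by (rule sum.mono_neutral_right) (use fin\<Lambda> a zero i in auto)
      then show ?thesis using psi_v[OF i] by simp
    qed
    then have "H *\<^sub>v \<psi> = of_real a \<cdot>\<^sub>v \<psi>"
      using H \<psi> evv[OF a(1)]
      by (intro eq_vecI) (auto simp: scalar_prod_def atLeast0LessThan eigvec_at_def)
    moreover have "\<psi> \<noteq> 0\<^sub>v d" using \<psi> by auto
    ultimately have "eigenvector H \<psi> (of_real a)"
      using H \<psi> by (simp add: eigenvector_def)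
    then show False using ne by blast
  qed
  then obtain b where b: "b \<in> \<Lambda>" "a \<noteq> b" "(\<Sum>i<d. (norm (v b i))\<^sup>2) \<noteq> 0" by blast
  have evolved: "evolved H \<psi> t $ i = (\<Sum>l\<in>\<Lambda>. cis (- l * t) * v l i)" if "i < d" for t i
    unfolding evolved_def evo[OF that]
    using restrict[OF that, of "\<lambda>l. exp (- \<i> * complex_of_real t * l)"]
    by (simp add: cis_conv_exp algebra_simps)
  have pos: "0 < (\<Sum>i<d. (norm (v l i))\<^sup>2)" if "(\<Sum>i<d. (norm (v l i))\<^sup>2) \<noteq> 0" for l
    using that by (simp add: sum_nonneg order.strict_iff_order)
  have two: "\<exists>a\<in>\<Lambda>. \<exists>b\<in>\<Lambda>. a \<noteq> b \<and> 0 < (\<Sum>i<d. (norm (v a i))\<^sup>2) \<and> 0 < (\<Sum>i<d. (norm (v b i))\<^sup>2)"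
    using a(1) b(1,2) pos[OF a(2)] pos[OF b(3)] by blast
  have "energy_decomposition d \<Lambda> v" using fin\<Lambda> orth by unfold_locales
  then show thesis using evolved norms two by (intro that) auto
qed


section \<open>The fidelity bound\<close>

definition sesq :: "'i set \<Rightarrow> ('i \<Rightarrow> 'i \<Rightarrow> complex) \<Rightarrow> ('i \<Rightarrow> complex) \<Rightarrow> ('i \<Rightarrow> complex) \<Rightarrow> complex" where
  "sesq I Y x y = (\<Sum>r\<in>I. \<Sum>s\<in>I. cnj (x r) * Y r s * y s)"

definition psd_kernel :: "'i set \<Rightarrow> ('i \<Rightarrow> 'i \<Rightarrow> complex) \<Rightarrow> bool" where
  "psd_kernel I Y \<longleftrightarrow> (\<forall>x. 0 \<le> sesq I Y x x)"

lemma sesq_sum: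
  "sesq I Y (\<lambda>r. \<Sum>j\<in>J. c j * x j r) (\<lambda>r. \<Sum>k\<in>K. e k * y k r) =
    (\<Sum>j\<in>J. \<Sum>k\<in>K. cnj (c j) * e k * sesq I Y (x j) (y k))"
proof -
  have "sesq I Y (\<lambda>r. \<Sum>j\<in>J. c j * x j r) (\<lambda>r. \<Sum>k\<in>K. e k * y k r) =
      (\<Sum>r\<in>I. \<Sum>s\<in>I. \<Sum>j\<in>J. \<Sum>k\<in>K. cnj (c j) * e k * (cnj (x j r) * Y r s * y k s))"
    unfolding sesq_def
  proof (intro sum.cong refl)
    fix r s
    have "cnj (\<Sum>j\<in>J. c j * x j r) * Y r s * (\<Sum>k\<in>K. e k * y k s) =
        Y r s * (cnj (\<Sum>j\<in>J. c j * x j r) * (\<Sum>k\<in>K. e k * y k s))"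
      by (simp only: mult_ac)
    also have "\<dots> = (\<Sum>j\<in>J. \<Sum>k\<in>K. cnj (c j) * e k * (cnj (x j r) * Y r s * y k s))"
      unfolding cnj_sum sum_product unfolding sum_distrib_left complex_cnj_mult
      by (intro sum.cong refl) (simp only: mult_ac)
    finally show "cnj (\<Sum>j\<in>J. c j * x j r) * Y r s * (\<Sum>k\<in>K. e k * y k s) =
        (\<Sum>j\<in>J. \<Sum>k\<in>K. cnj (c j) * e k * (cnj (x j r) * Y r s * y k s))" .
  qed
  also have "\<dots> = (\<Sum>r\<in>I. \<Sum>j\<in>J. \<Sum>k\<in>K. \<Sum>s\<in>I. cnj (c j) * e k * (cnj (x j r) * Y r s * y k s))"
    by (rule sum.cong[OF refl], subst sum.swap, rule sum.cong[OF refl], rule sum.swap)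
  also have "\<dots> = (\<Sum>j\<in>J. \<Sum>k\<in>K. \<Sum>r\<in>I. \<Sum>s\<in>I. cnj (c j) * e k * (cnj (x j r) * Y r s * y k s))"
    by (subst sum.swap, rule sum.cong[OF refl], rule sum.swap)
  finally show ?thesis by (simp add: sesq_def sum_distrib_left)
qed

text \<open>For \<open>\<Pi>\<close> the orthogonal projection onto the span of the \<open>B w\<close>, the trace of
  \<open>Y\<close> exceeds that of \<open>\<Pi> Y \<Pi>\<close> by the trace of the positive operator \<open>(1 - \<Pi>) Y (1 - \<Pi>)\<close>.\<close>

lemma psd_kernel_bessel:
  assumes I: "finite I" and \<Omega>: "finite \<Omega>" and psd: "psd_kernel I Y"
    and orth: "\<And>w w'. w \<in> \<Omega> \<Longrightarrow> w' \<in> \<Omega> \<Longrightarrow>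
      (\<Sum>r\<in>I. cnj (B w r) * B w' r) = (if w = w' then complex_of_real (\<nu> w) else 0)"
    and le: "\<And>w. w \<in> \<Omega> \<Longrightarrow> \<nu> w \<le> q" and q: "0 \<le> q"
  shows "(\<Sum>w\<in>\<Omega>. Re (sesq I Y (B w) (B w))) \<le> q * (\<Sum>r\<in>I. Re (Y r r))"
proof -
  have pos: "0 \<le> Re (sesq I Y x x)" for x
    using psd by (auto simp: psd_kernel_def less_eq_complex_def)
  have nu_eq: "\<nu> w = (\<Sum>r\<in>I. (norm (B w r))\<^sup>2)" if "w \<in> \<Omega>" for w
  proof -
    have "complex_of_real (\<nu> w) = (\<Sum>r\<in>I. cnj (B w r) * B w r)" using orth[OF that that] by simp
    also have "\<dots> = complex_of_real (\<Sum>r\<in>I. (norm (B w r))\<^sup>2)"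
      by (simp only: of_real_sum complex_norm_square mult.commute)
    finally show ?thesis by (simp only: of_real_eq_iff)
  qed
  \<comment> \<open>Vectors of norm 0 are dropped so that the remaining ones can be
    normalised.\<close>
  define \<Omega>' where "\<Omega>' = {w \<in> \<Omega>. \<nu> w \<noteq> 0}"
  have fin': "finite \<Omega>'" using \<Omega> by (simp add: \<Omega>'_def)
  have zero: "sesq I Y (B w) (B w) = 0" if "w \<in> \<Omega> - \<Omega>'" for w
  proof -
    have "B w r = 0" if "r \<in> I" for r
      using that nu_eq[of w] \<open>w \<in> \<Omega> - \<Omega>'\<close> I by (simp add: \<Omega>'_def sum_nonneg_eq_0_iff)
    then show ?thesis by (simp add: sesq_def)
  qed
  have nu_pos: "0 < \<nu> w" if "w \<in> \<Omega>'" for w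
    using that nu_eq[of w] by (simp add: \<Omega>'_def order.strict_iff_order sum_nonneg)
  define \<delta> where "\<delta> r s = (if s = r then 1 else 0 :: complex)" for r s :: 'a
  \<comment> \<open>The function \<open>\<lambda>s. \<pi> r s\<close> is \<open>\<Pi>\<close>
    applied to the \<open>r\<close>-th unit vector; as a matrix \<open>\<pi>\<close> is the
    transpose of \<open>\<Pi>\<close>.\<close>
  define \<pi> where "\<pi> r s = (\<Sum>w\<in>\<Omega>'. cnj (B w r) * B w s / of_real (\<nu> w))" for r s
  have cnj_delta: "cnj (\<delta> r s) = \<delta> r s" for r s by (simp add: \<delta>_def)
  have cnj_pi: "cnj (\<pi> r s) = \<pi> s r" for r s
    by (simp add: \<pi>_def mult.commute)
  have pi_pi: "(\<Sum>r\<in>I. \<pi> s r * \<pi> r s') = \<pi> s s'" for s s'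
  proof -
    have "(\<Sum>r\<in>I. \<pi> s r * \<pi> r s') = (\<Sum>r\<in>I. \<Sum>w\<in>\<Omega>'. \<Sum>w'\<in>\<Omega>'.
        (cnj (B w s) * B w' s' / (of_real (\<nu> w) * of_real (\<nu> w'))) * (cnj (B w' r) * B w r))"
      unfolding \<pi>_def sum_product by (intro sum.cong refl) simp
    also have "\<dots> = (\<Sum>w\<in>\<Omega>'. \<Sum>w'\<in>\<Omega>'.
        (cnj (B w s) * B w' s' / (of_real (\<nu> w) * of_real (\<nu> w'))) * (\<Sum>r\<in>I. cnj (B w' r) * B w r))"
      unfolding sum_distrib_left by (subst sum.swap, rule sum.cong[OF refl], rule sum.swap)
    also have "\<dots> = (\<Sum>w\<in>\<Omega>'. \<Sum>w'\<in>\<Omega>'. if w' = w then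
        cnj (B w s) * B w' s' / (of_real (\<nu> w) * of_real (\<nu> w')) * of_real (\<nu> w) else 0)"
      by (intro sum.cong refl) (simp add: orth \<Omega>'_def)
    also have "\<dots> = \<pi> s s'"
      unfolding \<pi>_def using fin' nu_pos by (intro sum.cong) (auto simp: field_simps)
    finally show ?thesis .
  qed
  have delta_sum: "(\<Sum>t\<in>I. \<delta> t r * f t) = f r" if "r \<in> I" for r f
  proof -
    have "(\<Sum>t\<in>I. \<delta> t r * f t) = (\<Sum>t\<in>I. if r = t then f t else 0)"
      by (intro sum.cong refl) (simp add: \<delta>_def)
    then show ?thesis using that I by simp
  qed
  have kernel: "(\<Sum>t\<in>I. cnj (\<delta> t r - \<pi> t r) * (\<delta> t s - \<pi> t s)) = \<delta> r s - \<pi> r s"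
    if "r \<in> I" "s \<in> I" for r s
  proof -
    have "(\<Sum>t\<in>I. cnj (\<delta> t r - \<pi> t r) * (\<delta> t s - \<pi> t s)) =
        (\<Sum>t\<in>I. \<delta> t r * \<delta> t s - \<delta> t r * \<pi> t s - \<delta> t s * \<pi> r t + \<pi> r t * \<pi> t s)"
      by (intro sum.cong refl) (simp only: complex_cnj_diff cnj_pi cnj_delta left_diff_distrib
          right_diff_distrib diff_diff_eq2 mult.commute diff_diff_add, simp)
    also have "\<dots> = \<delta> r s - \<pi> r s - \<pi> r s + \<pi> r s"
      by (simp only: sum.distrib sum_subtractf pi_pi delta_sum[OF that(1)] delta_sum[OF that(2)])
    finally show ?thesis by simp
  qed
  \<comment> \<open>The left side is the trace of \<open>(1 - \<Pi>) Y (1 - \<Pi>)\<close>. As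
    \<open>1 - \<Pi>\<close> is a selfadjoint idempotent, it equals the trace of \<open>Y\<close>
    minus that of \<open>Y \<Pi>\<close>.\<close>
  have "(\<Sum>t\<in>I. sesq I Y (\<lambda>r. \<delta> t r - \<pi> t r) (\<lambda>r. \<delta> t r - \<pi> t r)) =
      (\<Sum>r\<in>I. \<Sum>s\<in>I. Y r s * (\<Sum>t\<in>I. cnj (\<delta> t r - \<pi> t r) * (\<delta> t s - \<pi> t s)))"
    unfolding sesq_def sum_distrib_left
    by (subst sum.swap, rule sum.cong[OF refl], subst sum.swap, intro sum.cong refl) (simp only: mult_ac)
  also have "\<dots> = (\<Sum>r\<in>I. \<Sum>s\<in>I. Y r s * (\<delta> r s - \<pi> r s))"
    by (intro sum.cong refl) (simp only: kernel)
  also have "\<dots> = (\<Sum>r\<in>I. \<Sum>s\<in>I. Y r s * \<delta> r s) - (\<Sum>r\<in>I. \<Sum>s\<in>I. Y r s * \<pi> r s)"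
    by (simp add: right_diff_distrib sum_subtractf)
  also have "(\<Sum>r\<in>I. \<Sum>s\<in>I. Y r s * \<delta> r s) = (\<Sum>r\<in>I. Y r r)"
  proof (rule sum.cong[OF refl])
    fix r assume r: "r \<in> I"
    have "(\<Sum>s\<in>I. Y r s * \<delta> r s) = (\<Sum>s\<in>I. \<delta> s r * Y r s)"
      by (intro sum.cong refl) (simp add: \<delta>_def)
    then show "(\<Sum>s\<in>I. Y r s * \<delta> r s) = Y r r" using delta_sum[OF r] by simp
  qed
  also have "(\<Sum>r\<in>I. \<Sum>s\<in>I. Y r s * \<pi> r s) = (\<Sum>w\<in>\<Omega>'. sesq I Y (B w) (B w) / of_real (\<nu> w))"
  proof -
    have "(\<Sum>r\<in>I. \<Sum>s\<in>I. Y r s * \<pi> r s) =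
        (\<Sum>r\<in>I. \<Sum>s\<in>I. \<Sum>w\<in>\<Omega>'. cnj (B w r) * Y r s * B w s / of_real (\<nu> w))"
      unfolding \<pi>_def sum_distrib_left by (intro sum.cong refl) simp
    also have "\<dots> = (\<Sum>r\<in>I. \<Sum>w\<in>\<Omega>'. \<Sum>s\<in>I. cnj (B w r) * Y r s * B w s / of_real (\<nu> w))"
      by (rule sum.cong[OF refl], rule sum.swap)
    also have "\<dots> = (\<Sum>w\<in>\<Omega>'. \<Sum>r\<in>I. \<Sum>s\<in>I. cnj (B w r) * Y r s * B w s / of_real (\<nu> w))"
      by (rule sum.swap)
    finally show ?thesis by (simp add: sesq_def sum_divide_distrib)
  qed
  finally have "Re (\<Sum>t\<in>I. sesq I Y (\<lambda>r. \<delta> t r - \<pi> t r) (\<lambda>r. \<delta> t r - \<pi> t r)) =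
      Re ((\<Sum>r\<in>I. Y r r) - (\<Sum>w\<in>\<Omega>'. sesq I Y (B w) (B w) / of_real (\<nu> w)))"
    by (rule arg_cong)
  then have "(\<Sum>t\<in>I. Re (sesq I Y (\<lambda>r. \<delta> t r - \<pi> t r) (\<lambda>r. \<delta> t r - \<pi> t r))) =
      (\<Sum>r\<in>I. Re (Y r r)) - (\<Sum>w\<in>\<Omega>'. Re (sesq I Y (B w) (B w)) / \<nu> w)"
    by (simp only: Re_sum minus_complex.sel Re_divide_of_real)
  moreover have "0 \<le> (\<Sum>t\<in>I. Re (sesq I Y (\<lambda>r. \<delta> t r - \<pi> t r) (\<lambda>r. \<delta> t r - \<pi> t r)))"
    by (intro sum_nonneg pos)
  ultimately have tr: "(\<Sum>w\<in>\<Omega>'. Re (sesq I Y (B w) (B w)) / \<nu> w) \<le> (\<Sum>r\<in>I. Re (Y r r))" by simp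
  show ?thesis
  proof -
    have "(\<Sum>w\<in>\<Omega>. Re (sesq I Y (B w) (B w))) = (\<Sum>w\<in>\<Omega>'. Re (sesq I Y (B w) (B w)))"
      by (rule sum.mono_neutral_right) (use \<Omega> zero in \<open>auto simp: \<Omega>'_def\<close>)
    also have "\<dots> \<le> (\<Sum>w\<in>\<Omega>'. q * (Re (sesq I Y (B w) (B w)) / \<nu> w))"
    proof (rule sum_mono)
      fix w assume w: "w \<in> \<Omega>'"
      have "Re (sesq I Y (B w) (B w)) * \<nu> w \<le> Re (sesq I Y (B w) (B w)) * q"
        using le w pos by (intro mult_left_mono) (auto simp: \<Omega>'_def)
      then show "Re (sesq I Y (B w) (B w)) \<le> q * (Re (sesq I Y (B w) (B w)) / \<nu> w)"
        using nu_pos[OF w] by (simp add: field_simps)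
    qed
    also have "\<dots> \<le> q * (\<Sum>r\<in>I. Re (Y r r))"
      unfolding sum_distrib_left[symmetric] using tr q by (rule mult_left_mono)
    finally show ?thesis .
  qed
qed

text \<open>This is the Bessel bound for a single vector. It serves to show that a kernel without
  trace has a vanishing form.\<close>

lemma sesq_le_norm_trace:
  assumes "finite I" "psd_kernel I Y"
  shows "Re (sesq I Y x x) \<le> (\<Sum>r\<in>I. (norm (x r))\<^sup>2) * (\<Sum>r\<in>I. Re (Y r r))"
proof -
  have "(\<Sum>r\<in>I. cnj (x r) * x r) = complex_of_real (\<Sum>r\<in>I. (norm (x r))\<^sup>2)"
    by (simp only: of_real_sum complex_norm_square mult.commute)
  then have "(\<Sum>w\<in>{()}. Re (sesq I Y x x)) \<le> (\<Sum>r\<in>I. (norm (x r))\<^sup>2) * (\<Sum>r\<in>I. Re (Y r r))"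
    by (intro psd_kernel_bessel[where \<nu> = "\<lambda>_. \<Sum>r\<in>I. (norm (x r))\<^sup>2"] assms)
      (auto intro: sum_nonneg)
  then show ?thesis by simp
qed

lemma sesq_cong:
  assumes "\<And>r. r \<in> I \<Longrightarrow> x r = x' r" "\<And>r. r \<in> I \<Longrightarrow> y r = y' r"
  shows "sesq I Y x y = sesq I Y x' y'"
  unfolding sesq_def by (intro sum.cong refl) (simp only: assms)

lemma sesq_times:
  "sesq (S \<times> T) Y x y = (\<Sum>E\<in>S. \<Sum>a\<in>T. \<Sum>E'\<in>S. \<Sum>b\<in>T. cnj (x (E, a)) * Y (E, a) (E', b) * y (E', b))"
  by (simp add: sesq_def sum.cartesian_product')

section \<open>Block operators of linear and completely positive maps\<close>

lemma linear_op_map_sum: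
  assumes P: "linear_op_map n m P" and J: "finite J" and ab: "a < m" "b < m"
  shows "P (mat n n (\<lambda>ij. \<Sum>x\<in>J. c x * K x ij)) $$ (a, b) = (\<Sum>x\<in>J. c x * P (mat n n (K x)) $$ (a, b))"
  using J
proof (induction J rule: finite_induct)
  case empty
  let ?Z = "0\<^sub>m n n :: complex mat"
  have Z: "0 \<cdot>\<^sub>m ?Z = ?Z" "?Z = mat n n (\<lambda>ij. 0)" by (auto intro!: eq_matI)
  have "P ?Z \<in> carrier_mat m m" and "P (0 \<cdot>\<^sub>m ?Z) = 0 \<cdot>\<^sub>m P ?Z"
    using P zero_carrier_mat[of n n] unfolding linear_op_map_def by blast+
  then have "P ?Z $$ (a, b) = 0 * P ?Z $$ (a, b)"
    using ab unfolding Z(1) by (metis carrier_matD index_smult_mat(1))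
  then show ?case using Z(2) by simp
next
  case (insert x J)
  have add: "P (A + B) = P A + P B" if "A \<in> carrier_mat n n" "B \<in> carrier_mat n n" for A B
    using P that unfolding linear_op_map_def by blast
  have smult: "P (a \<cdot>\<^sub>m A) = a \<cdot>\<^sub>m P A" if "A \<in> carrier_mat n n" for a A
    using P that unfolding linear_op_map_def by blast
  have "mat n n (\<lambda>ij. \<Sum>x\<in>insert x J. c x * K x ij) =
      c x \<cdot>\<^sub>m mat n n (K x) + mat n n (\<lambda>ij. \<Sum>x\<in>J. c x * K x ij)"
    using insert by (intro eq_matI) auto
  moreover have "P (c x \<cdot>\<^sub>m mat n n (K x) + mat n n (\<lambda>ij. \<Sum>x\<in>J. c x * K x ij)) =
      c x \<cdot>\<^sub>m P (mat n n (K x)) + P (mat n n (\<lambda>ij. \<Sum>x\<in>J. c x * K x ij))"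
    by (simp add: add smult)
  moreover have "dim_row (P (mat n n f)) = m" "dim_col (P (mat n n f)) = m" for f
    using P by (metis carrier_matD linear_op_map_def mat_carrier)+
  ultimately show ?case using insert ab by simp
qed

lemma positive_op_ket_bra: "positive_op (dim_vec V) (ket_bra V)"
  unfolding positive_op_def
proof (intro conjI ballI)
  fix w :: "complex vec" assume w: "w \<in> carrier_vec (dim_vec V)"
  define z where "z = (\<Sum>j<dim_vec V. cnj (V $ j) * w $ j)"
  have "(ket_bra V *\<^sub>v w) \<bullet>c w = (\<Sum>i<dim_vec V. (V $ i * z) * cnj (w $ i))"
    using w by (simp add: ket_bra_def scalar_prod_def atLeast0LessThan z_def sum_distrib_left mult.assoc)
  also have "\<dots> = z * (\<Sum>i<dim_vec V. V $ i * cnj (w $ i))"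
    by (simp add: sum_distrib_left mult_ac)
  also have "(\<Sum>i<dim_vec V. V $ i * cnj (w $ i)) = cnj z"
    by (simp add: z_def)
  also have "z * cnj z = of_real ((norm z)\<^sup>2)" by (rule complex_norm_square[symmetric])
  finally show "0 \<le> (ket_bra V *\<^sub>v w) \<bullet>c w" by (simp add: less_eq_complex_def)
qed (simp add: ket_bra_def)

text \<open>These are the entries of the block operator
  \<open>[P (|A E\<rangle>\<langle>A E'|)]\<close>: first components of the indices select the
  block, second components the entry in it. Keeping pairs avoids numbering the energies.\<close>

definition rank_one_image ::
  "nat \<Rightarrow> (complex mat \<Rightarrow> complex mat) \<Rightarrow> ('s \<Rightarrow> nat \<Rightarrow> complex) \<Rightarrow> 's \<times> nat \<Rightarrow> 's \<times> nat \<Rightarrow> complex" where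
  "rank_one_image n P A r s =
     P (mat n n (\<lambda>(i, j). A (fst r) i * cnj (A (fst s) j))) $$ (snd r, snd s)"

text \<open>Complete positivity is used only for the rank one operator of the vector
  \<open>\<Sum>E\<in>S. |E\<rangle> \<otimes> A E\<close>, with an ancilla of dimension \<open>card S\<close>.\<close>

lemma completely_positive_psd_kernel:
  assumes P: "completely_positive n m P" and S: "finite S"
  shows "psd_kernel (S \<times> {..<m}) (rank_one_image n P A)"
  unfolding psd_kernel_def
proof
  fix x :: "'a \<times> nat \<Rightarrow> complex"
  define k where "k = card S"
  obtain e where e: "bij_betw e {..<k} S"
    using ex_bij_betw_nat_finite[OF S] by (auto simp: k_def atLeast0LessThan)
  \<comment> \<open>Through the enumeration \<open>e\<close> of \<open>S\<close>, the
    \<open>i\<close>-th segment of \<open>V\<close> is \<open>A (e i)\<close>, so the blocks of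
    \<open>ket_bra V\<close> are the required rank one operators; \<open>W\<close> flattens
    \<open>x\<close> in the same way.\<close>
  define V where "V = vec (k * n) (\<lambda>r. A (e (r div n)) (r mod n))"
  define W where "W = vec (k * m) (\<lambda>r. x (e (r div m), r mod m))"
  define G where "G E a E' b = cnj (x (E, a)) * rank_one_image n P A (E, a) (E', b) * x (E', b)" for E a E' b
  have block: "mat_block n (ket_bra V) i j = mat n n (\<lambda>(a, b). A (e i) a * cnj (A (e j) b))"
    if "i < k" "j < k" for i j
  proof -
    have "i * n + a < k * n" if "i < k" "a < n" for i a
    proof -
      have "i * n + a < Suc i * n" using that by simp
      also have "\<dots> \<le> k * n" using that by (intro mult_le_mono1) simp
      finally show ?thesis .
    qed
    then show ?thesis
      using that by (intro eq_matI) (auto simp: mat_block_def ket_bra_def V_def)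
  qed
  have "positive_op (k * n) (ket_bra V)"
    using positive_op_ket_bra[of V] by (simp add: V_def)
  then have "positive_op (k * m) (ampliation k n m P (ket_bra V))"
    using P by (simp add: completely_positive_def)
  then have "0 \<le> (ampliation k n m P (ket_bra V) *\<^sub>v W) \<bullet>c W"
    by (simp add: positive_op_def W_def)
  also have "(ampliation k n m P (ket_bra V) *\<^sub>v W) \<bullet>c W =
      (\<Sum>r<k * m. \<Sum>s<k * m. cnj (W $ r) * ampliation k n m P (ket_bra V) $$ (r, s) * W $ s)"
    by (simp add: W_def ampliation_def scalar_prod_def atLeast0LessThan sum_distrib_left
        sum_distrib_right mult_ac)
  also have "\<dots> = (\<Sum>r<k * m. \<Sum>s<k * m. G (e (r div m)) (r mod m) (e (s div m)) (s mod m))"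
    by (intro sum.cong refl)
      (simp add: G_def W_def ampliation_def rank_one_image_def block div_less_of_less_mult)
  also have "\<dots> = (\<Sum>r<k * m. \<Sum>j<k. \<Sum>b<m. G (e (r div m)) (r mod m) (e j) b)"
    by (rule sum.cong[OF refl], rule sum_div_mod[where f = "\<lambda>j. G _ _ (e j)"])
  also have "\<dots> = (\<Sum>i<k. \<Sum>a<m. \<Sum>j<k. \<Sum>b<m. G (e i) a (e j) b)"
    by (rule sum_div_mod[where f = "\<lambda>i a. \<Sum>j<k. \<Sum>b<m. G (e i) a (e j) b"])
  also have "\<dots> = (\<Sum>i<k. \<Sum>a<m. \<Sum>E'\<in>S. \<Sum>b<m. G (e i) a E' b)"
    by (intro sum.cong refl sum.reindex_bij_betw[OF e, where g = "\<lambda>E'. \<Sum>b<m. G _ _ E' b"])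
  also have "\<dots> = (\<Sum>E\<in>S. \<Sum>a<m. \<Sum>E'\<in>S. \<Sum>b<m. G E a E' b)"
    by (rule sum.reindex_bij_betw[OF e, where g = "\<lambda>E. \<Sum>a<m. \<Sum>E'\<in>S. \<Sum>b<m. G E a E' b"])
  also have "\<dots> = sesq (S \<times> {..<m}) (rank_one_image n P A) x x"
    by (simp add: sesq_times G_def)
  finally show "0 \<le> sesq (S \<times> {..<m}) (rank_one_image n P A) x x" .
qed

section \<open>The fidelity for fixed numbers of copies\<close>

context energy_decomposition
begin

lemma component_orthogonal_shift:
  assumes "finite S"
  shows "(\<Sum>r\<in>S \<times> {..<d ^ M}. cnj (component M (fst r + w) (snd r)) * component M (fst r + w') (snd r)) =
    (if w = w' then complex_of_real (\<Sum>E\<in>S. energy_prob M (E + w)) else 0)"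
proof -
  have "(\<Sum>r\<in>S \<times> {..<d ^ M}. cnj (component M (fst r + w) (snd r)) * component M (fst r + w') (snd r)) =
      (\<Sum>E\<in>S. \<Sum>a<d ^ M. cnj (component M (E + w) a) * component M (E + w') a)"
    by (simp add: sum.cartesian_product split_def)
  then show ?thesis by (simp add: component_inner)
qed

text \<open>The hypothesis on \<open>q\<close> bounds the squared norms of all \<open>B w\<close> at
  once, so the estimate reduces to comparing time means of numerator and denominator.\<close>

lemma fidelity_le:
  assumes dim: "\<And>t. dim_vec (\<phi> t) = d"
    and \<phi>: "\<And>t i. i < d \<Longrightarrow> \<phi> t $ i = (\<Sum>l\<in>\<Lambda>. cis (- l * t) * v l i)"
    and P: "replication_process d \<phi> N M P"
    and q: "\<And>w. (\<Sum>E\<in>energies N. energy_prob M (E + w)) \<le> q"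
  shows "0 \<le> replication_fidelity \<phi> N M P" "replication_fidelity \<phi> N M P \<le> q"
proof -
  let ?n = "d ^ N" and ?m = "d ^ M"
  have lin: "linear_op_map ?n ?m P" and cp: "completely_positive ?n ?m P"
    and ex: "\<exists>t. success_weight \<phi> N P t \<noteq> 0"
    using P by (auto simp: replication_process_def)
  define S where "S = energies N"
  define I where "I = S \<times> {..<?m}"
  define Y where "Y = rank_one_image ?n P (component N)"
  have finS: "finite S" and finI: "finite I" by (simp_all add: S_def I_def finite_energies)
  have psd: "psd_kernel I Y"
    unfolding I_def Y_def by (rule completely_positive_psd_kernel[OF cp finS])
  have psd_nonneg: "0 \<le> sesq I Y x x" for x using psd by (simp add: psd_kernel_def)
  define Tr where "Tr = (\<Sum>r\<in>I. Re (Y r r))"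
  define \<rho> where "\<rho> t = kron_mat_pow (ket_bra (\<phi> t)) N" for t
  define num where "num t = (P (\<rho> t) *\<^sub>v kron_vec_pow (\<phi> t) M) \<bullet>c kron_vec_pow (\<phi> t) M" for t
  define wgt where "wgt t = success_weight \<phi> N P t" for t

  have rho_carrier: "\<rho> t \<in> carrier_mat ?n ?n" for t
    unfolding \<rho>_def kron_mat_pow_ket_bra by (simp add: ket_bra_def dim)
  have P_rho_dim: "P (\<rho> t) \<in> carrier_mat ?m ?m" for t
    using lin rho_carrier by (simp add: linear_op_map_def)
  have P_rho: "P (\<rho> t) $$ (a, b) = (\<Sum>E\<in>S. \<Sum>E'\<in>S. cis ((E' - E) * t) * Y (E, a) (E', b))"
    if "a < ?m" "b < ?m" for t a b
  proof -
    have "\<rho> t = mat ?n ?n (\<lambda>ij. \<Sum>x\<in>S \<times> S. cis ((snd x - fst x) * t) *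
        (\<lambda>(i, j). component N (fst x) i * cnj (component N (snd x) j)) ij)"
    proof (rule eq_matI)
      fix i j
      assume "i < dim_row (mat ?n ?n (\<lambda>ij. \<Sum>x\<in>S \<times> S. cis ((snd x - fst x) * t) *
          (\<lambda>(i, j). component N (fst x) i * cnj (component N (snd x) j)) ij))"
        "j < dim_col (mat ?n ?n (\<lambda>ij. \<Sum>x\<in>S \<times> S. cis ((snd x - fst x) * t) *
          (\<lambda>(i, j). component N (fst x) i * cnj (component N (snd x) j)) ij))"
      then have ij: "i < ?n" "j < ?n" by auto
      have "\<rho> t $$ (i, j) = kron_vec_pow (\<phi> t) N $ i * cnj (kron_vec_pow (\<phi> t) N $ j)"
        unfolding \<rho>_def kron_mat_pow_ket_bra using ij by (simp add: ket_bra_def dim)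
      also have "\<dots> = (\<Sum>E\<in>S. cis (- E * t) * component N E i) *
          (\<Sum>E'\<in>S. cis (E' * t) * cnj (component N E' j))"
        using kron_vec_pow_component[OF dim \<phi>] ij by (simp add: S_def cis_cnj)
      also have "\<dots> = (\<Sum>x\<in>S \<times> S. cis ((snd x - fst x) * t) *
          (component N (fst x) i * cnj (component N (snd x) j)))"
        unfolding sum_product sum.cartesian_product split_def
      proof (rule sum.cong[OF refl])
        fix x
        have "cis ((snd x - fst x) * t) = cis (- fst x * t) * cis (snd x * t)"
          by (simp add: cis_mult algebra_simps)
        then show "cis (- fst x * t) * component N (fst x) i * (cis (snd x * t) * cnj (component N (snd x) j)) =
            cis ((snd x - fst x) * t) * (component N (fst x) i * cnj (component N (snd x) j))"
          by (simp only: mult_ac)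
      qed
      finally show "\<rho> t $$ (i, j) = mat ?n ?n (\<lambda>ij. \<Sum>x\<in>S \<times> S. cis ((snd x - fst x) * t) *
          (\<lambda>(i, j). component N (fst x) i * cnj (component N (snd x) j)) ij) $$ (i, j)"
        using ij by simp
    qed (use rho_carrier[of t] in auto)
    then have "P (\<rho> t) $$ (a, b) = (\<Sum>x\<in>S \<times> S. cis ((snd x - fst x) * t) *
        P (mat ?n ?n (\<lambda>(i, j). component N (fst x) i * cnj (component N (snd x) j))) $$ (a, b))"
      using finS that by (simp only:) (rule linear_op_map_sum[OF lin], auto)
    then show ?thesis
      by (simp add: Y_def rank_one_image_def sum.cartesian_product split_def)
  qed
  have wgt: "wgt t = (\<Sum>a<?m. \<Sum>E\<in>S. \<Sum>E'\<in>S. cis ((E' - E) * t) * Y (E, a) (E', a))" for t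
    using P_rho_dim[of t] by (simp add: wgt_def success_weight_def mat_trace_def P_rho flip: \<rho>_def)
  \<comment> \<open>The phases move from the input state to the test vector, so that every quantity
    at time \<open>t\<close> becomes a value of the form of the fixed kernel
    \<open>Y\<close>.\<close>
  define ph where "ph t K r = cis (fst r * t) * K (snd r)" for t :: real and K :: "nat \<Rightarrow> complex" and r
  have sesq_ph: "sesq I Y (ph t K) (ph t K) = (\<Sum>a<?m. \<Sum>b<?m. cnj (K a) * P (\<rho> t) $$ (a, b) * K b)" for t K
  proof -
    have "sesq I Y (ph t K) (ph t K) =
        (\<Sum>E\<in>S. \<Sum>a<?m. \<Sum>E'\<in>S. \<Sum>b<?m. cnj (K a) * (cis ((E' - E) * t) * Y (E, a) (E', b)) * K b)"
      unfolding I_def sesq_times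
    proof (intro sum.cong refl)
      fix E a E' b
      have "cis ((E' - E) * t) = cnj (cis (E * t)) * cis (E' * t)"
        by (simp add: cis_mult cis_cnj algebra_simps)
      then show "cnj (ph t K (E, a)) * Y (E, a) (E', b) * ph t K (E', b) =
          cnj (K a) * (cis ((E' - E) * t) * Y (E, a) (E', b)) * K b"
        unfolding ph_def by (simp only: fst_conv snd_conv complex_cnj_mult mult_ac)
    qed
    also have "\<dots> = (\<Sum>a<?m. \<Sum>E\<in>S. \<Sum>E'\<in>S. \<Sum>b<?m. cnj (K a) * (cis ((E' - E) * t) * Y (E, a) (E', b)) * K b)"
      by (rule sum.swap)
    also have "\<dots> = (\<Sum>a<?m. \<Sum>E\<in>S. \<Sum>b<?m. \<Sum>E'\<in>S. cnj (K a) * (cis ((E' - E) * t) * Y (E, a) (E', b)) * K b)"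
      by (intro sum.cong refl sum.swap)
    also have "\<dots> = (\<Sum>a<?m. \<Sum>b<?m. \<Sum>E\<in>S. \<Sum>E'\<in>S. cnj (K a) * (cis ((E' - E) * t) * Y (E, a) (E', b)) * K b)"
      by (intro sum.cong refl sum.swap)
    also have "\<dots> = (\<Sum>a<?m. \<Sum>b<?m. cnj (K a) * P (\<rho> t) $$ (a, b) * K b)"
      by (intro sum.cong refl) (simp add: P_rho sum_distrib_left sum_distrib_right)
    finally show ?thesis .
  qed
  \<comment> \<open>The trace is summed over unit vectors, which exhibits the success weight as a
    sum of values of the positive form.\<close>
  have wgt_sesq: "wgt t = (\<Sum>c<?m. sesq I Y (ph t (\<lambda>a. if a = c then 1 else 0)) (ph t (\<lambda>a. if a = c then 1 else 0)))" for t
  proof -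
    have "(\<Sum>a<?m. \<Sum>b<?m. cnj (if a = c then 1 else 0) * P (\<rho> t) $$ (a, b) * (if b = c then 1 else 0)) =
        P (\<rho> t) $$ (c, c)" if "c < ?m" for c
    proof -
      have "(\<Sum>a<?m. \<Sum>b<?m. cnj (if a = c then 1 else 0) * P (\<rho> t) $$ (a, b) * (if b = c then 1 else 0)) =
          (\<Sum>a<?m. \<Sum>b<?m. if b = c then if a = c then P (\<rho> t) $$ (a, b) else 0 else 0)"
        by (intro sum.cong refl) simp
      also have "\<dots> = P (\<rho> t) $$ (c, c)" using that by simp
      finally show ?thesis .
    qed
    then show ?thesis
      using P_rho_dim[of t] by (simp add: sesq_ph wgt_def success_weight_def mat_trace_def flip: \<rho>_def)
  qed

  define W where "W t = ph t (\<lambda>a. kron_vec_pow (\<phi> t) M $ a)" for t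
  have num_sesq: "num t = sesq I Y (W t) (W t)" for t
    using P_rho_dim[of t]
    by (simp add: W_def sesq_ph num_def scalar_prod_def atLeast0LessThan dim sum_distrib_left
        sum_distrib_right mult_ac)
  \<comment> \<open>The test vector carries the phase \<open>cis (E * t)\<close> from
    \<open>ph\<close> and \<open>cis (- F * t)\<close> from the target state, so its frequencies are
    the differences \<open>F - E\<close>; \<open>B w\<close> collects the part with
    \<open>F - E = w\<close>.\<close>
  define \<Omega> where "\<Omega> = (\<lambda>(F, E). F - E) ` (energies M \<times> S)"
  define B where "B w r = component M (fst r + w) (snd r)" for w and r :: "real \<times> nat"
  have fin\<Omega>: "finite \<Omega>" using finS by (simp add: \<Omega>_def finite_energies)
  have W_B: "W t r = (\<Sum>w\<in>\<Omega>. cis (- w * t) * B w r)" if r: "r \<in> I" for t r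
  proof -
    have "(\<Sum>w\<in>\<Omega>. cis (- w * t) * B w r) = (\<Sum>w\<in>\<Omega>. cis (- w * t) * component M (w - (- fst r)) (snd r))"
      by (simp add: B_def add.commute)
    also have "\<dots> = (\<Sum>F\<in>energies M. cis (- (F + - fst r) * t) * component M F (snd r))"
      using r fin\<Omega> by (intro sum_shift_support finite_energies)
        (auto simp: component_outside \<Omega>_def I_def)
    also have "\<dots> = cis (fst r * t) * (\<Sum>F\<in>energies M. cis (- F * t) * component M F (snd r))"
      unfolding sum_distrib_left mult.assoc[symmetric] cis_mult
      by (intro sum.cong refl) (simp add: algebra_simps)
    also have "\<dots> = W t r"
      using r kron_vec_pow_component[OF dim \<phi>] by (simp add: W_def ph_def I_def mem_Times_iff)
    finally show ?thesis by simp
  qed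
  have num: "num t = (\<Sum>x\<in>\<Omega> \<times> \<Omega>. sesq I Y (B (fst x)) (B (snd x)) * cis ((fst x - snd x) * t))" for t
  proof -
    have "num t = sesq I Y (\<lambda>r. \<Sum>w\<in>\<Omega>. cis (- w * t) * B w r) (\<lambda>r. \<Sum>w\<in>\<Omega>. cis (- w * t) * B w r)"
      unfolding num_sesq by (rule sesq_cong) (rule W_B, assumption)+
    also have "\<dots> = (\<Sum>w\<in>\<Omega>. \<Sum>w'\<in>\<Omega>. cnj (cis (- w * t)) * cis (- w' * t) * sesq I Y (B w) (B w'))"
      by (rule sesq_sum)
    also have "\<dots> = (\<Sum>w\<in>\<Omega>. \<Sum>w'\<in>\<Omega>. sesq I Y (B w) (B w') * cis ((w - w') * t))"
      by (intro sum.cong refl) (simp add: cis_cnj cis_mult algebra_simps)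
    finally show ?thesis by (simp add: sum.cartesian_product split_def)
  qed

  have B_orth: "(\<Sum>r\<in>I. cnj (B w r) * B w' r) =
      (if w = w' then complex_of_real (\<Sum>E\<in>S. energy_prob M (E + w)) else 0)" for w w'
    unfolding I_def B_def by (rule component_orthogonal_shift[OF finS])
  have q0: "0 \<le> q"
    using q[of 0] by (rule order_trans[rotated]) (simp add: sum_nonneg energy_prob_nonneg)
  have bessel: "(\<Sum>w\<in>\<Omega>. Re (sesq I Y (B w) (B w))) \<le> q * Tr"
    unfolding Tr_def using q by (intro psd_kernel_bessel[OF finI fin\<Omega> psd B_orth _ q0]) (simp add: S_def)

  have wgt_nonneg: "0 \<le> wgt t" for t unfolding wgt_sesq by (intro sum_nonneg psd_nonneg)
  have num_nonneg: "0 \<le> num t" for t unfolding num_sesq by (rule psd_nonneg)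
  have quot: "Re (num t / wgt t) = Re (num t) / Re (wgt t)" for t
    using wgt_nonneg[of t] by (simp add: less_eq_complex_def complex_eq_iff Re_divide power2_eq_square)
  have quot_nonneg: "0 \<le> Re (num t / wgt t)" for t
    using wgt_nonneg[of t] num_nonneg[of t] unfolding quot by (simp add: less_eq_complex_def)
  define F where "F = replication_fidelity \<phi> N M P"
  have F_eq: "F = (INF t\<in>{t. wgt t \<noteq> 0}. Re (num t / wgt t))"
    by (simp add: F_def replication_fidelity_def num_def wgt_def \<rho>_def)
  have ne: "{t. wgt t \<noteq> 0} \<noteq> {}" using ex by (auto simp: wgt_def)
  have F0: "0 \<le> F" unfolding F_eq by (rule cINF_greatest[OF ne]) (rule quot_nonneg)
  \<comment> \<open>Clearing the denominator extends the inequality to times of zero success weight,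
    where the left side is 0. It then holds at all times and can be averaged.\<close>
  have F_num: "F * Re (wgt t) \<le> Re (num t)" for t
  proof (cases "wgt t = 0")
    case True
    then show ?thesis using num_nonneg[of t] by (simp add: less_eq_complex_def)
  next
    case False
    have "F \<le> Re (num t / wgt t)"
      unfolding F_eq using False quot_nonneg by (intro cINF_lower bdd_belowI2[of _ 0]) auto
    moreover have "0 < Re (wgt t)"
      using False wgt_nonneg[of t] by (auto simp: less_eq_complex_def complex_eq_iff order.strict_iff_order)
    ultimately show ?thesis by (simp add: quot field_simps)
  qed

  \<comment> \<open>With zero trace the form would vanish, and with it the success weight at every
    time, against the definition of a replication process.\<close>
  have Tr_pos: "0 < Tr"
  proof (rule ccontr)
    assume "\<not> 0 < Tr"
    then have "Re (sesq I Y x x) \<le> 0" for x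
      using sesq_le_norm_trace[OF finI psd, of x]
        mult_nonneg_nonpos[of "\<Sum>r\<in>I. (norm (x r))\<^sup>2" Tr]
      by (simp add: Tr_def sum_nonneg)
    then have "Re (wgt t) \<le> 0" for t unfolding wgt_sesq Re_sum by (rule sum_nonpos)
    then have "wgt t = 0" for t
      using wgt_nonneg[of t] by (auto simp: less_eq_complex_def complex_eq_iff intro: antisym)
    then show False using ne by simp
  qed
  \<comment> \<open>Averaging keeps \<open>E = E'\<close> on the left, which gives
    \<open>F * Tr\<close>, and \<open>w = w'\<close> on the right, which gives the Bessel
    sum.\<close>
  have "Re (\<Sum>x | x \<in> S \<times> S \<and> snd x - fst x = 0. of_real F * (\<Sum>a<?m. Y (fst x, a) (snd x, a)))
      \<le> Re (\<Sum>x | x \<in> \<Omega> \<times> \<Omega> \<and> fst x - snd x = 0. sesq I Y (B (fst x)) (B (snd x)))"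
  proof (rule trig_sum_mean_mono)
    fix t
    have "(\<Sum>x\<in>S \<times> S. of_real F * (\<Sum>a<?m. Y (fst x, a) (snd x, a)) * cis ((snd x - fst x) * t)) =
        of_real F * wgt t"
    proof -
      have "wgt t = (\<Sum>E\<in>S. \<Sum>a<?m. \<Sum>E'\<in>S. cis ((E' - E) * t) * Y (E, a) (E', a))"
        unfolding wgt by (rule sum.swap)
      also have "\<dots> = (\<Sum>E\<in>S. \<Sum>E'\<in>S. \<Sum>a<?m. cis ((E' - E) * t) * Y (E, a) (E', a))"
        by (intro sum.cong refl sum.swap)
      also have "\<dots> = (\<Sum>x\<in>S \<times> S. (\<Sum>a<?m. Y (fst x, a) (snd x, a)) * cis ((snd x - fst x) * t))"
        by (simp add: sum.cartesian_product' sum_distrib_left mult.commute)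
      finally have "of_real F * wgt t = of_real F *
          (\<Sum>x\<in>S \<times> S. (\<Sum>a<?m. Y (fst x, a) (snd x, a)) * cis ((snd x - fst x) * t))" by simp
      then show ?thesis unfolding sum_distrib_left[of "of_real F" _ "S \<times> S"] by (simp only: mult.assoc)
    qed
    then show "Re (\<Sum>x\<in>S \<times> S. of_real F * (\<Sum>a<?m. Y (fst x, a) (snd x, a)) * cis ((snd x - fst x) * t))
        \<le> Re (\<Sum>x\<in>\<Omega> \<times> \<Omega>. sesq I Y (B (fst x)) (B (snd x)) * cis ((fst x - snd x) * t))"
      using F_num[of t] by (simp add: num)
  qed (use finS fin\<Omega> in auto)
  moreover have "{x. x \<in> S \<times> S \<and> snd x - fst x = 0} = (\<lambda>E. (E, E)) ` S"
    and "{x. x \<in> \<Omega> \<times> \<Omega> \<and> fst x - snd x = 0} = (\<lambda>E. (E, E)) ` \<Omega>"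
    by auto
  ultimately have "Re (\<Sum>E\<in>S. of_real F * (\<Sum>a<?m. Y (E, a) (E, a))) \<le> (\<Sum>w\<in>\<Omega>. Re (sesq I Y (B w) (B w)))"
    by (simp add: sum.reindex inj_on_def)
  moreover have "Re (\<Sum>E\<in>S. of_real F * (\<Sum>a<?m. Y (E, a) (E, a))) = F * Tr"
    by (simp add: Tr_def I_def sum.cartesian_product' sum_distrib_left)
  ultimately have "F * Tr \<le> q * Tr" using bessel by linarith
  then show "replication_fidelity \<phi> N M P \<le> q" using Tr_pos by (simp add: F_def)
  show "0 \<le> replication_fidelity \<phi> N M P" using F0 by (simp add: F_def)
qed

end


section \<open>Passage to the limit in the number of copies\<close>

theorem theorem2:
  fixes d :: nat and H :: "complex mat" and \<psi> :: "complex vec"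
    and \<epsilon> c :: real and M :: "nat \<Rightarrow> nat"
    and P :: "nat \<Rightarrow> complex mat \<Rightarrow> complex mat"
  assumes "H \<in> carrier_mat d d" and "mat_adjoint H = H"
    and "\<psi> \<in> carrier_vec d" and "\<psi> \<bullet>c \<psi> = 1"
    and "\<nexists>E. eigenvector H \<psi> E"
    and "\<epsilon> > 0" and "c > 0"
    and "\<And>N. N \<ge> 1 \<Longrightarrow> replication_process d (evolved H \<psi>) N (M N) (P N)"
    and "\<And>N. N \<ge> 1 \<Longrightarrow> real (M N) \<ge> c * real N powr (2 + \<epsilon>)"
  shows "(\<lambda>N. replication_fidelity (evolved H \<psi>) N (M N) (P N)) \<longlonglongrightarrow> 0"
proof -
  obtain \<Lambda> v where dec: "energy_decomposition d \<Lambda> v"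
    and evo: "\<forall>t. \<forall>i<d. evolved H \<psi> t $ i = (\<Sum>l\<in>\<Lambda>. cis (- l * t) * v l i)"
    and total: "(\<Sum>l\<in>\<Lambda>. \<Sum>i<d. (norm (v l i))\<^sup>2) = 1"
    and two: "\<exists>a\<in>\<Lambda>. \<exists>b\<in>\<Lambda>. a \<noteq> b \<and> 0 < (\<Sum>i<d. (norm (v a i))\<^sup>2) \<and> 0 < (\<Sum>i<d. (norm (v b i))\<^sup>2)"
    by (rule evolved_energy_components[OF assms(1-5)])
  interpret energy_decomposition d \<Lambda> v by (rule dec)
  obtain k T where k: "0 < k" and T: "0 < T"
    and decay: "\<And>t. \<bar>t\<bar> \<le> T \<Longrightarrow> norm (\<Sum>l\<in>\<Lambda>. of_real (weight l) * cis (l * t)) \<le> exp (- (k * t\<^sup>2))"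
    using characteristic_function_decay[where p = weight, OF finite_spectrum weight_nonneg] total two unfolding weight_def[symmetric] by blast
  \<comment> \<open>The sum bounds every single energy, and the added \<open>1 / T\<close> makes the
    window radius \<open>R * real N\<close> admissible in \<open>concentration_bound\<close> for all
    \<open>N \<ge> 1\<close>.\<close>
  define R where "R = 1 / T + (\<Sum>l\<in>\<Lambda>. \<bar>l\<bar>)"
  have R_ge: "1 / T \<le> R" by (simp add: R_def sum_nonneg)
  have R_pos: "0 < R" by (rule less_le_trans[OF _ R_ge]) (simp add: T)
  have R_bound: "\<bar>l\<bar> \<le> R" if "l \<in> \<Lambda>" for l
    using member_le_sum[OF that, of abs] finite_spectrum T by (simp add: R_def add_increasing)
  \<comment> \<open>Since \<open>M N\<close> is at least
    \<open>c * real N powr (2 + \<epsilon>)\<close>, the squared window radius cancels the power 2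
    of \<open>N\<close> and leaves \<open>K * real N powr \<epsilon>\<close> over the square of the
    kernel order.\<close>
  define K where "K = k * c / R\<^sup>2"
  have K: "0 < K" using k R_pos \<open>c > 0\<close> by (simp add: K_def)
  define f where "f N = replication_fidelity (evolved H \<psi>) N (M N) (P N)" for N
  have dim: "dim_vec (evolved H \<psi> t) = d" for t
    using assms(1) by (simp add: evolved_def mat_exp_def)
  have f_bounds: "0 \<le> f N \<and> f N \<le> 4 / real n + 4 * exp (- (K / (real n)\<^sup>2 * real N powr \<epsilon>))"
    if N: "1 \<le> N" and n: "1 \<le> n" for N n
  proof -
    have "1 / T \<le> R * 1" using R_ge by simp
    also have "\<dots> \<le> R * real N" using N R_pos by (intro mult_left_mono) auto
    finally have L: "1 / T \<le> R * real N" .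
    define q where "q = 4 / real n + 4 * exp (- (k * real (M N) / (real n * (R * real N))\<^sup>2))"
    have "(\<Sum>E\<in>energies N. energy_prob (M N) (E + w)) \<le> q" for w
    proof -
      have "(\<Sum>E\<in>energies N. energy_prob (M N) (E + w)) \<le>
          (\<Sum>F | F \<in> energies (M N) \<and> \<bar>F - w\<bar> \<le> R * real N. energy_prob (M N) F)"
        by (rule energy_prob_window[OF R_bound])
      also have "\<dots> \<le> q"
        unfolding q_def
        by (rule concentration_bound[OF finite_energies energy_prob_nonneg n _ L T k energy_characteristic decay])
          (use R_pos N in auto)
      finally show ?thesis .
    qed
    then have "0 \<le> f N" "f N \<le> q"
      unfolding f_def using fidelity_le[OF dim _ assms(8)[OF N]] evo by blast+
    moreover have "q \<le> 4 / real n + 4 * exp (- (K / (real n)\<^sup>2 * real N powr \<epsilon>))"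
    proof -
      have "K / (real n)\<^sup>2 * real N powr \<epsilon> \<le> k * real (M N) / (real n * (R * real N))\<^sup>2"
      proof -
        have "real N powr (2 + \<epsilon>) = (real N)\<^sup>2 * real N powr \<epsilon>"
          using N by (simp add: powr_add powr_realpow)
        then have "K / (real n)\<^sup>2 * real N powr \<epsilon> = k * (c * real N powr (2 + \<epsilon>)) / (real n * (R * real N))\<^sup>2"
          using N n R_pos by (simp add: K_def power_mult_distrib field_simps)
        also have "\<dots> \<le> k * real (M N) / (real n * (R * real N))\<^sup>2"
          using assms(9)[OF N] k by (intro divide_right_mono mult_left_mono) auto
        finally show ?thesis .
      qed
      then show ?thesis unfolding q_def by (intro add_left_mono mult_left_mono) simp_all
    qed
    ultimately show ?thesis by linarith
  qed
  have "f \<longlonglongrightarrow> 0"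
  proof (rule tendstoI)
    fix e :: real assume e: "0 < e"
    \<comment> \<open>The kernel order is fixed first, making \<open>4 / real n < e / 2\<close>. For
      this \<open>n\<close> the exponential term is then below \<open>e / 2\<close> once
      \<open>N\<close> is large.\<close>
    obtain n :: nat where n_gt: "8 / e < real n" using reals_Archimedean2 by blast
    moreover have "0 < 8 / e" using e by simp
    ultimately have n_pos: "0 < real n" by linarith
    then have n: "1 \<le> n" "4 / real n < e / 2"
      using n_gt e by (auto simp: field_simps)
    define C where "C = K / (real n)\<^sup>2"
    have C: "0 < C" using K n by (simp add: C_def)
    have "(\<lambda>N. real N powr - \<epsilon>) \<longlonglongrightarrow> 0"
      using \<open>\<epsilon> > 0\<close> by (intro tendsto_neg_powr filterlim_real_sequentially) simp
    then have "\<forall>\<^sub>F N in sequentially. real N powr - \<epsilon> < C * (e / 8)"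
      using e C by (intro order_tendstoD) auto
    then show "\<forall>\<^sub>F N in sequentially. dist (f N) 0 < e"
      using eventually_ge_at_top[of 1]
    proof eventually_elim
      case (elim N)
      \<comment> \<open>The inequality \<open>exp (- x) \<le> 1 / x\<close> for positive
        \<open>x\<close> reduces the claim to the decay of
        \<open>real N powr - \<epsilon>\<close>.\<close>
      have "C * real N powr \<epsilon> \<le> exp (C * real N powr \<epsilon>)"
        using exp_ge_add_one_self[of "C * real N powr \<epsilon>"] by linarith
      then have "exp (- (C * real N powr \<epsilon>)) \<le> inverse (C * real N powr \<epsilon>)"
        unfolding exp_minus using C elim(2) by (intro le_imp_inverse_le) auto
      also have "\<dots> < e / 8" using elim C by (simp add: powr_minus field_simps)
      finally show ?case using f_bounds[OF elim(2) n(1)] n(2) by (simp add: C_def)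
    qed
  qed
  then show ?thesis by (simp add: f_def[abs_def])
qed

end
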